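(* (Monotonicity of the $\star$-translation.) For every type-variable context $\Delta$ and any term $e$ and computational type $C$ of the language $\mathrm{DM}$: $\Delta\mid\cdot\vdash e:C\,!\,n$ implies $\underline\Delta\models e^\star\lesssim_{C^\star}e^\star$.
   Context: **The language $\mathrm{DM}$.** Effects $\epsilon\in\{n,\tau\}$ ($n$ non-effectful, $\tau$ an abstract monad). Types: $A::=X\mid b\mid A\xrightarrow{n}A\mid A+A\mid A\times A$; $H::=A\mid C$; $C::=H\xrightarrow{\tau}A\mid H\xrightarrow{n}C\mid C\times C$, where $X$ ranges over type variables and $b$ over base types. Terms: $e::=x\mid e\,e\mid\lambda x{:}H.e\mid\kappa(e,\dots,e)\mid(e,e)\mid\mathbf{fst}(e)\mid\mathbf{snd}(e)\mid\mathbf{inl}(e)\mid\mathbf{inr}(e)\mid\mathbf{case}\,e\,\mathbf{inl}\,x{:}A.e;\mathbf{inr}\,y{:}A.e\mid\mathbf{return}_\tau\,e\mid\mathbf{bind}_\tau\,e\,\mathbf{to}\,x\,\mathbf{in}\,e$, with $\kappa$ constants. Judgments are $\Delta\mid\Gamma\vdash e:H\,!\,n$ and $\Delta\mid\Gamma\vdash e:A\,!\,\tau$; $\Delta$ is a finite sequence of type variables, $\Gamma$ a list of bindings $x{:}H$ with distinct variables and types over $\Delta$ ($\cdot$ is the empty list). All types appearing in rules must be well formed by the grammar. Rules: variables ($x{:}H\in\Gamma$ gives $x:H!n$); constants ($\kappa:b_1,\dots,b_n\to b$ and $e_i:b_i!n$ give $\kappa(e_1,\dots,e_n):b!n$); $\Gamma,x{:}H\vdash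 e:H'!\epsilon$ gives $\lambda x{:}H.e:H\xrightarrow{\epsilon}H'\,!\,n$; $f:H\xrightarrow{\epsilon}H'!n$ and $e:H!n$ give $f\,e:H'!\epsilon$; $e:H!n$, $e':H'!n$ give $(e,e'):H\times H'!n$; projections from $e:H\times H'!n$ have effect $n$; $e:A!n$ gives $\mathbf{inl}(e):A+A'!n$ (similarly $\mathbf{inr}$); $e:A+A'!n$, $\Gamma,x{:}A\vdash e_1:H!\epsilon$, $\Gamma,y{:}A'\vdash e_2:H!\epsilon$ give $\mathbf{case}\,e\,\mathbf{inl}\,x{:}A.e_1;\mathbf{inr}\,y{:}A'.e_2:H!\epsilon$; $e:A!n$ gives $\mathbf{return}_\tau\,e:A!\tau$; $e_1:A!\tau$ and $\Gamma,x{:}A\vdash e_2:A'!\tau$ give $\mathbf{bind}_\tau\,e_1\,\mathbf{to}\,x\,\mathbf{in}\,e_2:A'!\tau$. **The $\star$-translation** into $\mathrm{EMF}^\star$. On types: $A^\star$ is $A$ with every $\xrightarrow{n}$ replaced by $\to$; $(H\xrightarrow{n}C)^\star=H^\star\to C^\star$; $(C\times C')^\star=C^\star\times C'^\star$; $(H\xrightarrow{\tau}A)^\star=H^\star\to(A^\star\to\mathsf{Type}_0)\to\mathsf{Type}_0$. On terms (defined over typing derivations): $(\mathbf{return}_\tau\,e)^\star=\lambda p{:}(A^\star\to\mathsf{Type}_0).\,p\,e^\star$ when $e:A!n$; $(\mathbf{bind}_\tau\,e_1\,\mathbf{to}\,x\,\mathbf{in}\,e_2)^\star=\lambda p{:}(A'^\star\to\mathsf{Type}_0).\,e_1^\star\,(\lambda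 x{:}A^\star.\,e_2^\star\,p)$ when $e_1:A!\tau$, $e_2:A'!\tau$; all other constructs homomorphically ($(\lambda x{:}H.e)^\star=\lambda x{:}H^\star.e^\star$, etc.). If $\Delta=X_1,\dots,X_m$ then $\underline\Delta=X_1{:}\mathsf{Type}_0,\dots,X_m{:}\mathsf{Type}_0$. **Target and validity.** $\mathrm{EMF}^\star$ is a dependently typed $\lambda$-calculus with predicative universes $\mathsf{Type}_0:\mathsf{Type}_1:\cdots$; only its total fragment (functions, pairs, sums with case analysis, base types and constants of $\mathrm{DM}$) matters here. Formulas are terms of type $\mathsf{Type}_0$, with squashed (proof-irrelevant) connectives. $\Gamma\models\phi$ is $\mathrm{EMF}^\star$'s validity judgment: a proof-irrelevant classical higher-order logic with the usual rules for hypotheses, $\wedge,\vee,\Rightarrow,\forall,\exists$, propositional equality $==$ (reflexive, substitutive, containing $\beta\eta$-reduction, extensional on functions) and case analysis on sums. **The relation $\lesssim$** ("stronger than"), defined by recursion on non-dependent total types, yields an $\mathrm{EMF}^\star$ formula: - $x\lesssim_{\mathsf{Type}_0}y$ is $x\Rightarrow y$; - $x\lesssim_b y$ and $x\lesssim_X y$ are $x==y$, for $b$ a base type and $X$ a type variable; - $f\lesssim_{t_1\to t_2}g$ is $\forall x,y{:}t_1.\ x\lesssim_{t_1}x\wedge x\lesssim_{t_1}y\wedge y\lesssim_{t_1}y\Rightarrow f\,x\lesssim_{t_2}g\,y$; - $x\lesssim_{t_1\times t_2}y$ is $\mathsf{fst}\,x\lesssim_{t_1}\mathsf{fst}\,y\wedge\mathsf{snd}\,x\lesssim_{t_2}\mathsf{snd}\,y$;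 - $x\lesssim_{t_1+t_2}y$ is $(\exists v_1,v_2{:}t_1.\ x==\mathsf{inl}\,v_1\wedge y==\mathsf{inl}\,v_2\wedge v_1\lesssim_{t_1}v_2)\vee(\exists v_1,v_2{:}t_2.\ x==\mathsf{inr}\,v_1\wedge y==\mathsf{inr}\,v_2\wedge v_1\lesssim_{t_2}v_2)$. *)

theory Defs
  imports Main
begin

text \<open>
  Term variables are de Bruijn indices in both languages, so terms are taken up to
  renaming of bound variables and the bindings of a context are automatically distinct.
  Nothing binds type variables, so these are named.  Base types (type \<open>'b\<close>) and constants
  (type \<open>'k\<close>) are arbitrary; a signature \<open>Sg\<close> sends a constant with typing
  \<open>b\<^sub>1, \<dots>, b\<^sub>n \<rightarrow> b\<close> to the pair of \<open>[b\<^sub>1, \<dots>, b\<^sub>n]\<close> and \<open>b\<close>.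
\<close>

type_synonym tyvar = string
type_synonym ('k, 'b) signature = "'k \<Rightarrow> 'b list \<times> 'b"


section \<open>The language DM\<close>

datatype eff = EffN | EffTau

text \<open>Raw types; the grammars of \<open>A\<close>, \<open>C\<close> and \<open>H\<close> are the predicates below.\<close>

datatype 'b dty =
    DVarT tyvar
  | DBase 'b
  | DFun eff "'b dty" "'b dty"
  | DSum "'b dty" "'b dty"
  | DProd "'b dty" "'b dty"

fun val_ty :: "tyvar list \<Rightarrow> 'b dty \<Rightarrow> bool" where
  "val_ty \<Delta> (DVarT X) = (X \<in> set \<Delta>)"
| "val_ty \<Delta> (DBase b) = True"
| "val_ty \<Delta> (DFun EffN A A') = (val_ty \<Delta> A \<and> val_ty \<Delta> A')"
| "val_ty \<Delta> (DFun EffTau A A') = False"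
| "val_ty \<Delta> (DSum A A') = (val_ty \<Delta> A \<and> val_ty \<Delta> A')"
| "val_ty \<Delta> (DProd A A') = (val_ty \<Delta> A \<and> val_ty \<Delta> A')"

fun comp_ty :: "tyvar list \<Rightarrow> 'b dty \<Rightarrow> bool" where
  "comp_ty \<Delta> (DFun EffTau H A) = ((val_ty \<Delta> H \<or> comp_ty \<Delta> H) \<and> val_ty \<Delta> A)"
| "comp_ty \<Delta> (DFun EffN H C) = ((val_ty \<Delta> H \<or> comp_ty \<Delta> H) \<and> comp_ty \<Delta> C)"
| "comp_ty \<Delta> (DProd C C') = (comp_ty \<Delta> C \<and> comp_ty \<Delta> C')"
| "comp_ty \<Delta> _ = False"

definition dm_ty :: "tyvar list \<Rightarrow> 'b dty \<Rightarrow> bool" where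
  "dm_ty \<Delta> H \<longleftrightarrow> val_ty \<Delta> H \<or> comp_ty \<Delta> H"

datatype ('b, 'k) dtm =
    DVar nat
  | DApp "('b, 'k) dtm" "('b, 'k) dtm"
  | DLam "'b dty" "('b, 'k) dtm"
  | DConst 'k "('b, 'k) dtm list"
  | DPair "('b, 'k) dtm" "('b, 'k) dtm"
  | DFst "('b, 'k) dtm"
  | DSnd "('b, 'k) dtm"
  | DInl "('b, 'k) dtm"
  | DInr "('b, 'k) dtm"
  | DCase "('b, 'k) dtm" "'b dty" "('b, 'k) dtm" "'b dty" "('b, 'k) dtm"
  | DReturn "('b, 'k) dtm"
  | DBind "('b, 'k) dtm" "('b, 'k) dtm"

text \<open>
  \<open>dm_typing Sg \<Delta> \<Gamma> e H \<epsilon>\<close> is \<open>\<Delta> | \<Gamma> \<turnstile> e : H ! \<epsilon>\<close>.  The premises on types are those needed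
  to make every type of a derivation grammatical (see \<open>dm_typing_wf\<close>): in particular they
  exclude the arrow from \<open>H\<close> to \<open>A\<close> with effect \<open>n\<close> for computational \<open>H\<close>, and products of
  an \<open>A\<close> and a \<open>C\<close>.
\<close>

inductive dm_typing ::
  "('k, 'b) signature \<Rightarrow> tyvar list \<Rightarrow> 'b dty list \<Rightarrow> ('b, 'k) dtm \<Rightarrow> 'b dty \<Rightarrow> eff \<Rightarrow> bool"
  for Sg \<Delta>
where
  T_Var: "\<lbrakk>\<forall>H\<in>set \<Gamma>. dm_ty \<Delta> H; i < length \<Gamma>\<rbrakk> \<Longrightarrow> dm_typing Sg \<Delta> \<Gamma> (DVar i) (\<Gamma> ! i) EffN"
| T_Const: "\<lbrakk>\<forall>H\<in>set \<Gamma>. dm_ty \<Delta> H; Sg k = (bs, b); length es = length bs;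
     \<forall>i<length bs. dm_typing Sg \<Delta> \<Gamma> (es ! i) (DBase (bs ! i)) EffN\<rbrakk>
   \<Longrightarrow> dm_typing Sg \<Delta> \<Gamma> (DConst k es) (DBase b) EffN"
| T_Lam: "\<lbrakk>dm_ty \<Delta> (DFun \<epsilon> H H'); dm_typing Sg \<Delta> (H # \<Gamma>) e H' \<epsilon>\<rbrakk>
   \<Longrightarrow> dm_typing Sg \<Delta> \<Gamma> (DLam H e) (DFun \<epsilon> H H') EffN"
| T_App: "\<lbrakk>dm_typing Sg \<Delta> \<Gamma> f (DFun \<epsilon> H H') EffN; dm_typing Sg \<Delta> \<Gamma> e H EffN\<rbrakk>
   \<Longrightarrow> dm_typing Sg \<Delta> \<Gamma> (DApp f e) H' \<epsilon>"
| T_Pair: "\<lbrakk>dm_ty \<Delta> (DProd H H'); dm_typing Sg \<Delta> \<Gamma> e H EffN; dm_typing Sg \<Delta> \<Gamma> e' H' EffN\<rbrakk>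
   \<Longrightarrow> dm_typing Sg \<Delta> \<Gamma> (DPair e e') (DProd H H') EffN"
| T_Fst: "dm_typing Sg \<Delta> \<Gamma> e (DProd H H') EffN \<Longrightarrow> dm_typing Sg \<Delta> \<Gamma> (DFst e) H EffN"
| T_Snd: "dm_typing Sg \<Delta> \<Gamma> e (DProd H H') EffN \<Longrightarrow> dm_typing Sg \<Delta> \<Gamma> (DSnd e) H' EffN"
| T_Inl: "\<lbrakk>val_ty \<Delta> (DSum A A'); dm_typing Sg \<Delta> \<Gamma> e A EffN\<rbrakk>
   \<Longrightarrow> dm_typing Sg \<Delta> \<Gamma> (DInl e) (DSum A A') EffN"
| T_Inr: "\<lbrakk>val_ty \<Delta> (DSum A A'); dm_typing Sg \<Delta> \<Gamma> e A' EffN\<rbrakk>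
   \<Longrightarrow> dm_typing Sg \<Delta> \<Gamma> (DInr e) (DSum A A') EffN"
| T_Case: "\<lbrakk>dm_typing Sg \<Delta> \<Gamma> e (DSum A A') EffN;
     dm_typing Sg \<Delta> (A # \<Gamma>) e1 H \<epsilon>; dm_typing Sg \<Delta> (A' # \<Gamma>) e2 H \<epsilon>\<rbrakk>
   \<Longrightarrow> dm_typing Sg \<Delta> \<Gamma> (DCase e A e1 A' e2) H \<epsilon>"
| T_Return: "\<lbrakk>val_ty \<Delta> A; dm_typing Sg \<Delta> \<Gamma> e A EffN\<rbrakk>
   \<Longrightarrow> dm_typing Sg \<Delta> \<Gamma> (DReturn e) A EffTau"
| T_Bind: "\<lbrakk>dm_typing Sg \<Delta> \<Gamma> e1 A EffTau; dm_typing Sg \<Delta> (A # \<Gamma>) e2 A' EffTau\<rbrakk>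
   \<Longrightarrow> dm_typing Sg \<Delta> \<Gamma> (DBind e1 e2) A' EffTau"

lemma dm_typing_wf:
  assumes "dm_typing Sg \<Delta> \<Gamma> e H \<epsilon>"
  shows "(\<forall>H\<in>set \<Gamma>. dm_ty \<Delta> H) \<and> dm_ty \<Delta> H \<and> (\<epsilon> = EffTau \<longrightarrow> val_ty \<Delta> H)"
  using assms
proof (induction rule: dm_typing.induct)
  case (T_App \<Gamma> f \<epsilon> H H' e)
  then show ?case by (cases \<epsilon>) (auto simp: dm_ty_def)
qed (auto simp: dm_ty_def)


section \<open>The simply typed total fragment of the target\<close>

datatype 'b ty =
    TVar tyvar
  | TBase 'b
  | Type0
  | TFun "'b ty" "'b ty"
  | TProd "'b ty" "'b ty"
  | TSum "'b ty" "'b ty"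

text \<open>
  In this fragment types do not depend on term variables or hypotheses, so a context splits
  into declarations \<open>X : Type0\<close> of type variables, the types of the term variables, and a
  list of hypotheses.
\<close>

type_synonym 'b tctx = "(tyvar \<times> 'b ty) list"

fun wf_ty :: "'b tctx \<Rightarrow> 'b ty \<Rightarrow> bool" where
  "wf_ty \<Delta> (TVar X) = ((X, Type0) \<in> set \<Delta>)"
| "wf_ty \<Delta> (TBase b) = True"
| "wf_ty \<Delta> Type0 = True"
| "wf_ty \<Delta> (TFun s t) = (wf_ty \<Delta> s \<and> wf_ty \<Delta> t)"
| "wf_ty \<Delta> (TProd s t) = (wf_ty \<Delta> s \<and> wf_ty \<Delta> t)"
| "wf_ty \<Delta> (TSum s t) = (wf_ty \<Delta> s \<and> wf_ty \<Delta> t)"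

text \<open>Formulas are terms of type \<open>Type0\<close>.  Equality carries its type argument explicitly.\<close>

datatype ('b, 'k) tm =
    Var nat
  | App "('b, 'k) tm" "('b, 'k) tm"
  | Lam "'b ty" "('b, 'k) tm"
  | Const 'k "('b, 'k) tm list"
  | Pair "('b, 'k) tm" "('b, 'k) tm"
  | Fst "('b, 'k) tm"
  | Snd "('b, 'k) tm"
  | Inl "('b, 'k) tm"
  | Inr "('b, 'k) tm"
  | Case "('b, 'k) tm" "'b ty" "('b, 'k) tm" "'b ty" "('b, 'k) tm"
  | Tru
  | Fls
  | And "('b, 'k) tm" "('b, 'k) tm"
  | Or "('b, 'k) tm" "('b, 'k) tm"
  | Imp "('b, 'k) tm" "('b, 'k) tm"
  | All "'b ty" "('b, 'k) tm"
  | Ex "'b ty" "('b, 'k) tm"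
  | Eq "'b ty" "('b, 'k) tm" "('b, 'k) tm"

text \<open>\<open>lift k e\<close> makes room in \<open>e\<close> for a new variable with index \<open>k\<close>.\<close>

primrec lift :: "nat \<Rightarrow> ('b, 'k) tm \<Rightarrow> ('b, 'k) tm" where
  "lift k (Var i) = (if i < k then Var i else Var (Suc i))"
| "lift k (App a b) = App (lift k a) (lift k b)"
| "lift k (Lam t a) = Lam t (lift (Suc k) a)"
| "lift k (Const c as) = Const c (map (lift k) as)"
| "lift k (Pair a b) = Pair (lift k a) (lift k b)"
| "lift k (Fst a) = Fst (lift k a)"
| "lift k (Snd a) = Snd (lift k a)"
| "lift k (Inl a) = Inl (lift k a)"
| "lift k (Inr a) = Inr (lift k a)"
| "lift k (Case a s b t c) = Case (lift k a) s (lift (Suc k) b) t (lift (Suc k) c)"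
| "lift k Tru = Tru"
| "lift k Fls = Fls"
| "lift k (And a b) = And (lift k a) (lift k b)"
| "lift k (Or a b) = Or (lift k a) (lift k b)"
| "lift k (Imp a b) = Imp (lift k a) (lift k b)"
| "lift k (All t a) = All t (lift (Suc k) a)"
| "lift k (Ex t a) = Ex t (lift (Suc k) a)"
| "lift k (Eq t a b) = Eq t (lift k a) (lift k b)"

text \<open>\<open>subst k u e\<close> replaces variable \<open>k\<close> of \<open>e\<close> by \<open>u\<close> and removes it from the context.\<close>

primrec subst :: "nat \<Rightarrow> ('b, 'k) tm \<Rightarrow> ('b, 'k) tm \<Rightarrow> ('b, 'k) tm" where
  "subst k u (Var i) = (if i < k then Var i else if i = k then u else Var (i - 1))"
| "subst k u (App a b) = App (subst k u a) (subst k u b)"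
| "subst k u (Lam t a) = Lam t (subst (Suc k) (lift 0 u) a)"
| "subst k u (Const c as) = Const c (map (subst k u) as)"
| "subst k u (Pair a b) = Pair (subst k u a) (subst k u b)"
| "subst k u (Fst a) = Fst (subst k u a)"
| "subst k u (Snd a) = Snd (subst k u a)"
| "subst k u (Inl a) = Inl (subst k u a)"
| "subst k u (Inr a) = Inr (subst k u a)"
| "subst k u (Case a s b t c) =
     Case (subst k u a) s (subst (Suc k) (lift 0 u) b) t (subst (Suc k) (lift 0 u) c)"
| "subst k u Tru = Tru"
| "subst k u Fls = Fls"
| "subst k u (And a b) = And (subst k u a) (subst k u b)"
| "subst k u (Or a b) = Or (subst k u a) (subst k u b)"
| "subst k u (Imp a b) = Imp (subst k u a) (subst k u b)"
| "subst k u (All t a) = All t (subst (Suc k) (lift 0 u) a)"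
| "subst k u (Ex t a) = Ex t (subst (Suc k) (lift 0 u) a)"
| "subst k u (Eq t a b) = Eq t (subst k u a) (subst k u b)"

text \<open>
  Quantified formulas are squashed, hence of type \<open>Type0\<close> whatever the universe of the
  type quantified over.
\<close>

inductive has_ty ::
  "('k, 'b) signature \<Rightarrow> 'b tctx \<Rightarrow> 'b ty list \<Rightarrow> ('b, 'k) tm \<Rightarrow> 'b ty \<Rightarrow> bool"
  for Sg \<Delta>
where
  "i < length \<Gamma> \<Longrightarrow> has_ty Sg \<Delta> \<Gamma> (Var i) (\<Gamma> ! i)"
| "\<lbrakk>has_ty Sg \<Delta> \<Gamma> f (TFun s t); has_ty Sg \<Delta> \<Gamma> a s\<rbrakk> \<Longrightarrow> has_ty Sg \<Delta> \<Gamma> (App f a) t"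
| "\<lbrakk>wf_ty \<Delta> s; has_ty Sg \<Delta> (s # \<Gamma>) a t\<rbrakk> \<Longrightarrow> has_ty Sg \<Delta> \<Gamma> (Lam s a) (TFun s t)"
| "\<lbrakk>Sg k = (bs, b); length as = length bs;
    \<forall>i<length bs. has_ty Sg \<Delta> \<Gamma> (as ! i) (TBase (bs ! i))\<rbrakk>
   \<Longrightarrow> has_ty Sg \<Delta> \<Gamma> (Const k as) (TBase b)"
| "\<lbrakk>has_ty Sg \<Delta> \<Gamma> a s; has_ty Sg \<Delta> \<Gamma> b t\<rbrakk> \<Longrightarrow> has_ty Sg \<Delta> \<Gamma> (Pair a b) (TProd s t)"
| "has_ty Sg \<Delta> \<Gamma> a (TProd s t) \<Longrightarrow> has_ty Sg \<Delta> \<Gamma> (Fst a) s"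
| "has_ty Sg \<Delta> \<Gamma> a (TProd s t) \<Longrightarrow> has_ty Sg \<Delta> \<Gamma> (Snd a) t"
| "\<lbrakk>wf_ty \<Delta> t; has_ty Sg \<Delta> \<Gamma> a s\<rbrakk> \<Longrightarrow> has_ty Sg \<Delta> \<Gamma> (Inl a) (TSum s t)"
| "\<lbrakk>wf_ty \<Delta> s; has_ty Sg \<Delta> \<Gamma> a t\<rbrakk> \<Longrightarrow> has_ty Sg \<Delta> \<Gamma> (Inr a) (TSum s t)"
| "\<lbrakk>has_ty Sg \<Delta> \<Gamma> a (TSum s t); has_ty Sg \<Delta> (s # \<Gamma>) b r; has_ty Sg \<Delta> (t # \<Gamma>) c r\<rbrakk>
   \<Longrightarrow> has_ty Sg \<Delta> \<Gamma> (Case a s b t c) r"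
| "has_ty Sg \<Delta> \<Gamma> Tru Type0"
| "has_ty Sg \<Delta> \<Gamma> Fls Type0"
| "\<lbrakk>has_ty Sg \<Delta> \<Gamma> a Type0; has_ty Sg \<Delta> \<Gamma> b Type0\<rbrakk> \<Longrightarrow> has_ty Sg \<Delta> \<Gamma> (And a b) Type0"
| "\<lbrakk>has_ty Sg \<Delta> \<Gamma> a Type0; has_ty Sg \<Delta> \<Gamma> b Type0\<rbrakk> \<Longrightarrow> has_ty Sg \<Delta> \<Gamma> (Or a b) Type0"
| "\<lbrakk>has_ty Sg \<Delta> \<Gamma> a Type0; has_ty Sg \<Delta> \<Gamma> b Type0\<rbrakk> \<Longrightarrow> has_ty Sg \<Delta> \<Gamma> (Imp a b) Type0"
| "\<lbrakk>wf_ty \<Delta> t; has_ty Sg \<Delta> (t # \<Gamma>) a Type0\<rbrakk> \<Longrightarrow> has_ty Sg \<Delta> \<Gamma> (All t a) Type0"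
| "\<lbrakk>wf_ty \<Delta> t; has_ty Sg \<Delta> (t # \<Gamma>) a Type0\<rbrakk> \<Longrightarrow> has_ty Sg \<Delta> \<Gamma> (Ex t a) Type0"
| "\<lbrakk>has_ty Sg \<Delta> \<Gamma> a t; has_ty Sg \<Delta> \<Gamma> b t\<rbrakk> \<Longrightarrow> has_ty Sg \<Delta> \<Gamma> (Eq t a b) Type0"

text \<open>
  \<open>valid Sg \<Delta> \<Gamma> \<Phi> \<phi>\<close>: \<open>\<phi>\<close> is valid in the context made of \<open>\<Delta>\<close>, \<open>\<Gamma>\<close> and the hypotheses \<open>\<Phi>\<close>.
  Typing premises keep derivable formulas well typed.  Types may be empty: quantifiers are
  instantiated only with terms typable in the current context.
\<close>

inductive valid ::
  "('k, 'b) signature \<Rightarrow> 'b tctx \<Rightarrow> 'b ty list \<Rightarrow> ('b, 'k) tm list \<Rightarrow> ('b, 'k) tm \<Rightarrow> bool"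
  for Sg \<Delta>
where
  V_Hyp: "\<lbrakk>\<phi> \<in> set \<Phi>; has_ty Sg \<Delta> \<Gamma> \<phi> Type0\<rbrakk> \<Longrightarrow> valid Sg \<Delta> \<Gamma> \<Phi> \<phi>"
| V_TruI: "valid Sg \<Delta> \<Gamma> \<Phi> Tru"
| V_FlsE: "\<lbrakk>valid Sg \<Delta> \<Gamma> \<Phi> Fls; has_ty Sg \<Delta> \<Gamma> \<phi> Type0\<rbrakk> \<Longrightarrow> valid Sg \<Delta> \<Gamma> \<Phi> \<phi>"
| V_Classical: "has_ty Sg \<Delta> \<Gamma> \<phi> Type0 \<Longrightarrow> valid Sg \<Delta> \<Gamma> \<Phi> (Or \<phi> (Imp \<phi> Fls))"
| V_AndI: "\<lbrakk>valid Sg \<Delta> \<Gamma> \<Phi> \<phi>; valid Sg \<Delta> \<Gamma> \<Phi> \<psi>\<rbrakk> \<Longrightarrow> valid Sg \<Delta> \<Gamma> \<Phi> (And \<phi> \<psi>)"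
| V_AndE1: "valid Sg \<Delta> \<Gamma> \<Phi> (And \<phi> \<psi>) \<Longrightarrow> valid Sg \<Delta> \<Gamma> \<Phi> \<phi>"
| V_AndE2: "valid Sg \<Delta> \<Gamma> \<Phi> (And \<phi> \<psi>) \<Longrightarrow> valid Sg \<Delta> \<Gamma> \<Phi> \<psi>"
| V_OrI1: "\<lbrakk>valid Sg \<Delta> \<Gamma> \<Phi> \<phi>; has_ty Sg \<Delta> \<Gamma> \<psi> Type0\<rbrakk> \<Longrightarrow> valid Sg \<Delta> \<Gamma> \<Phi> (Or \<phi> \<psi>)"
| V_OrI2: "\<lbrakk>valid Sg \<Delta> \<Gamma> \<Phi> \<psi>; has_ty Sg \<Delta> \<Gamma> \<phi> Type0\<rbrakk> \<Longrightarrow> valid Sg \<Delta> \<Gamma> \<Phi> (Or \<phi> \<psi>)"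
| V_OrE: "\<lbrakk>valid Sg \<Delta> \<Gamma> \<Phi> (Or \<phi> \<psi>); valid Sg \<Delta> \<Gamma> (\<phi> # \<Phi>) \<chi>; valid Sg \<Delta> \<Gamma> (\<psi> # \<Phi>) \<chi>\<rbrakk>
   \<Longrightarrow> valid Sg \<Delta> \<Gamma> \<Phi> \<chi>"
| V_ImpI: "\<lbrakk>has_ty Sg \<Delta> \<Gamma> \<phi> Type0; valid Sg \<Delta> \<Gamma> (\<phi> # \<Phi>) \<psi>\<rbrakk> \<Longrightarrow> valid Sg \<Delta> \<Gamma> \<Phi> (Imp \<phi> \<psi>)"
| V_ImpE: "\<lbrakk>valid Sg \<Delta> \<Gamma> \<Phi> (Imp \<phi> \<psi>); valid Sg \<Delta> \<Gamma> \<Phi> \<phi>\<rbrakk> \<Longrightarrow> valid Sg \<Delta> \<Gamma> \<Phi> \<psi>"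
| V_AllI: "\<lbrakk>wf_ty \<Delta> t; valid Sg \<Delta> (t # \<Gamma>) (map (lift 0) \<Phi>) \<phi>\<rbrakk> \<Longrightarrow> valid Sg \<Delta> \<Gamma> \<Phi> (All t \<phi>)"
| V_AllE: "\<lbrakk>valid Sg \<Delta> \<Gamma> \<Phi> (All t \<phi>); has_ty Sg \<Delta> \<Gamma> a t\<rbrakk> \<Longrightarrow> valid Sg \<Delta> \<Gamma> \<Phi> (subst 0 a \<phi>)"
| V_ExI: "\<lbrakk>wf_ty \<Delta> t; has_ty Sg \<Delta> (t # \<Gamma>) \<phi> Type0; has_ty Sg \<Delta> \<Gamma> a t;
     valid Sg \<Delta> \<Gamma> \<Phi> (subst 0 a \<phi>)\<rbrakk>
   \<Longrightarrow> valid Sg \<Delta> \<Gamma> \<Phi> (Ex t \<phi>)"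
| V_ExE: "\<lbrakk>valid Sg \<Delta> \<Gamma> \<Phi> (Ex t \<phi>); valid Sg \<Delta> (t # \<Gamma>) (\<phi> # map (lift 0) \<Phi>) (lift 0 \<psi>)\<rbrakk>
   \<Longrightarrow> valid Sg \<Delta> \<Gamma> \<Phi> \<psi>"
| V_Refl: "has_ty Sg \<Delta> \<Gamma> a t \<Longrightarrow> valid Sg \<Delta> \<Gamma> \<Phi> (Eq t a a)"
| V_Subst: "\<lbrakk>valid Sg \<Delta> \<Gamma> \<Phi> (Eq t a b); has_ty Sg \<Delta> (t # \<Gamma>) \<phi> Type0;
     valid Sg \<Delta> \<Gamma> \<Phi> (subst 0 a \<phi>)\<rbrakk>
   \<Longrightarrow> valid Sg \<Delta> \<Gamma> \<Phi> (subst 0 b \<phi>)"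
| V_Beta: "\<lbrakk>wf_ty \<Delta> s; has_ty Sg \<Delta> (s # \<Gamma>) a t; has_ty Sg \<Delta> \<Gamma> b s\<rbrakk>
   \<Longrightarrow> valid Sg \<Delta> \<Gamma> \<Phi> (Eq t (App (Lam s a) b) (subst 0 b a))"
| V_Eta: "has_ty Sg \<Delta> \<Gamma> f (TFun s t)
   \<Longrightarrow> valid Sg \<Delta> \<Gamma> \<Phi> (Eq (TFun s t) (Lam s (App (lift 0 f) (Var 0))) f)"
| V_FstBeta: "\<lbrakk>has_ty Sg \<Delta> \<Gamma> a s; has_ty Sg \<Delta> \<Gamma> b t\<rbrakk> \<Longrightarrow> valid Sg \<Delta> \<Gamma> \<Phi> (Eq s (Fst (Pair a b)) a)"
| V_SndBeta: "\<lbrakk>has_ty Sg \<Delta> \<Gamma> a s; has_ty Sg \<Delta> \<Gamma> b t\<rbrakk> \<Longrightarrow> valid Sg \<Delta> \<Gamma> \<Phi> (Eq t (Snd (Pair a b)) b)"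
| V_PairEta: "has_ty Sg \<Delta> \<Gamma> a (TProd s t)
   \<Longrightarrow> valid Sg \<Delta> \<Gamma> \<Phi> (Eq (TProd s t) (Pair (Fst a) (Snd a)) a)"
| V_CaseInl: "\<lbrakk>wf_ty \<Delta> t; has_ty Sg \<Delta> \<Gamma> a s; has_ty Sg \<Delta> (s # \<Gamma>) b r; has_ty Sg \<Delta> (t # \<Gamma>) c r\<rbrakk>
   \<Longrightarrow> valid Sg \<Delta> \<Gamma> \<Phi> (Eq r (Case (Inl a) s b t c) (subst 0 a b))"
| V_CaseInr: "\<lbrakk>wf_ty \<Delta> s; has_ty Sg \<Delta> \<Gamma> a t; has_ty Sg \<Delta> (s # \<Gamma>) b r; has_ty Sg \<Delta> (t # \<Gamma>) c r\<rbrakk>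
   \<Longrightarrow> valid Sg \<Delta> \<Gamma> \<Phi> (Eq r (Case (Inr a) s b t c) (subst 0 a c))"
| V_Ext: "\<lbrakk>has_ty Sg \<Delta> \<Gamma> f (TFun s t); has_ty Sg \<Delta> \<Gamma> g (TFun s t);
     valid Sg \<Delta> \<Gamma> \<Phi> (All s (Eq t (App (lift 0 f) (Var 0)) (App (lift 0 g) (Var 0))))\<rbrakk>
   \<Longrightarrow> valid Sg \<Delta> \<Gamma> \<Phi> (Eq (TFun s t) f g)"
| V_SumCases: "\<lbrakk>has_ty Sg \<Delta> \<Gamma> a (TSum s t);
     valid Sg \<Delta> (s # \<Gamma>) (Eq (TSum s t) (lift 0 a) (Inl (Var 0)) # map (lift 0) \<Phi>) (lift 0 \<phi>);
     valid Sg \<Delta> (t # \<Gamma>) (Eq (TSum s t) (lift 0 a) (Inr (Var 0)) # map (lift 0) \<Phi>) (lift 0 \<phi>)\<rbrakk>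
   \<Longrightarrow> valid Sg \<Delta> \<Gamma> \<Phi> \<phi>"


section \<open>The relation ``stronger than''\<close>

text \<open>
  \<open>stronger t x y\<close> is the formula \<open>x \<lesssim>\<^sub>t y\<close>.  Under the two binders, indices 1 and 0 are the
  first and the second bound variable, and \<open>lift2\<close> moves terms of the outer context there.
\<close>

abbreviation lift2 :: "('b, 'k) tm \<Rightarrow> ('b, 'k) tm" where
  "lift2 a \<equiv> lift 0 (lift 0 a)"

fun stronger :: "'b ty \<Rightarrow> ('b, 'k) tm \<Rightarrow> ('b, 'k) tm \<Rightarrow> ('b, 'k) tm" where
  "stronger Type0 x y = Imp x y"
| "stronger (TBase b) x y = Eq (TBase b) x y"
| "stronger (TVar X) x y = Eq (TVar X) x y"
| "stronger (TFun s t) f g =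
     All s (All s (Imp
       (And (stronger s (Var 1) (Var 1)) (And (stronger s (Var 1) (Var 0)) (stronger s (Var 0) (Var 0))))
       (stronger t (App (lift2 f) (Var 1)) (App (lift2 g) (Var 0)))))"
| "stronger (TProd s t) x y = And (stronger s (Fst x) (Fst y)) (stronger t (Snd x) (Snd y))"
| "stronger (TSum s t) x y =
     Or (Ex s (Ex s (And (Eq (TSum s t) (lift2 x) (Inl (Var 1)))
          (And (Eq (TSum s t) (lift2 y) (Inl (Var 0))) (stronger s (Var 1) (Var 0))))))
        (Ex t (Ex t (And (Eq (TSum s t) (lift2 x) (Inr (Var 1)))
          (And (Eq (TSum s t) (lift2 y) (Inr (Var 0))) (stronger t (Var 1) (Var 0))))))"


section \<open>The star-translation\<close>

fun star_ty :: "'b dty \<Rightarrow> 'b ty" where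
  "star_ty (DVarT X) = TVar X"
| "star_ty (DBase b) = TBase b"
| "star_ty (DFun EffN H H') = TFun (star_ty H) (star_ty H')"
| "star_ty (DFun EffTau H A) = TFun (star_ty H) (TFun (TFun (star_ty A) Type0) Type0)"
| "star_ty (DSum A A') = TSum (star_ty A) (star_ty A')"
| "star_ty (DProd H H') = TProd (star_ty H) (star_ty H')"

definition star_tctx :: "tyvar list \<Rightarrow> 'b tctx" where
  "star_tctx \<Delta> = map (\<lambda>X. (X, Type0)) \<Delta>"

text \<open>
  \<open>dm_star Sg \<Delta> \<Gamma> e H \<epsilon> e'\<close>: some derivation of \<open>\<Delta> | \<Gamma> \<turnstile> e : H ! \<epsilon>\<close> translates \<open>e\<close> to \<open>e'\<close>.
  This is a relation because the type annotations in the translation of \<open>return\<close> and \<open>bind\<close>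
  come from the derivation, which \<open>e\<close> need not determine (injections carry no annotation).
  Its rules are those of \<open>dm_typing\<close>; every typable term has a translation by
  \<open>dm_typing_iff_dm_star\<close>.
\<close>

inductive dm_star ::
  "('k, 'b) signature \<Rightarrow> tyvar list \<Rightarrow> 'b dty list \<Rightarrow> ('b, 'k) dtm \<Rightarrow> 'b dty \<Rightarrow> eff
    \<Rightarrow> ('b, 'k) tm \<Rightarrow> bool"
  for Sg \<Delta>
where
  S_Var: "\<lbrakk>\<forall>H\<in>set \<Gamma>. dm_ty \<Delta> H; i < length \<Gamma>\<rbrakk> \<Longrightarrow> dm_star Sg \<Delta> \<Gamma> (DVar i) (\<Gamma> ! i) EffN (Var i)"
| S_Const: "\<lbrakk>\<forall>H\<in>set \<Gamma>. dm_ty \<Delta> H; Sg k = (bs, b); length es = length bs; length es' = length bs;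
     \<forall>i<length bs. dm_star Sg \<Delta> \<Gamma> (es ! i) (DBase (bs ! i)) EffN (es' ! i)\<rbrakk>
   \<Longrightarrow> dm_star Sg \<Delta> \<Gamma> (DConst k es) (DBase b) EffN (Const k es')"
| S_Lam: "\<lbrakk>dm_ty \<Delta> (DFun \<epsilon> H H'); dm_star Sg \<Delta> (H # \<Gamma>) e H' \<epsilon> u\<rbrakk>
   \<Longrightarrow> dm_star Sg \<Delta> \<Gamma> (DLam H e) (DFun \<epsilon> H H') EffN (Lam (star_ty H) u)"
| S_App: "\<lbrakk>dm_star Sg \<Delta> \<Gamma> f (DFun \<epsilon> H H') EffN u; dm_star Sg \<Delta> \<Gamma> e H EffN v\<rbrakk>
   \<Longrightarrow> dm_star Sg \<Delta> \<Gamma> (DApp f e) H' \<epsilon> (App u v)"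
| S_Pair: "\<lbrakk>dm_ty \<Delta> (DProd H H'); dm_star Sg \<Delta> \<Gamma> e H EffN u; dm_star Sg \<Delta> \<Gamma> e' H' EffN v\<rbrakk>
   \<Longrightarrow> dm_star Sg \<Delta> \<Gamma> (DPair e e') (DProd H H') EffN (Pair u v)"
| S_Fst: "dm_star Sg \<Delta> \<Gamma> e (DProd H H') EffN u \<Longrightarrow> dm_star Sg \<Delta> \<Gamma> (DFst e) H EffN (Fst u)"
| S_Snd: "dm_star Sg \<Delta> \<Gamma> e (DProd H H') EffN u \<Longrightarrow> dm_star Sg \<Delta> \<Gamma> (DSnd e) H' EffN (Snd u)"
| S_Inl: "\<lbrakk>val_ty \<Delta> (DSum A A'); dm_star Sg \<Delta> \<Gamma> e A EffN u\<rbrakk>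
   \<Longrightarrow> dm_star Sg \<Delta> \<Gamma> (DInl e) (DSum A A') EffN (Inl u)"
| S_Inr: "\<lbrakk>val_ty \<Delta> (DSum A A'); dm_star Sg \<Delta> \<Gamma> e A' EffN u\<rbrakk>
   \<Longrightarrow> dm_star Sg \<Delta> \<Gamma> (DInr e) (DSum A A') EffN (Inr u)"
| S_Case: "\<lbrakk>dm_star Sg \<Delta> \<Gamma> e (DSum A A') EffN u;
     dm_star Sg \<Delta> (A # \<Gamma>) e1 H \<epsilon> v; dm_star Sg \<Delta> (A' # \<Gamma>) e2 H \<epsilon> w\<rbrakk>
   \<Longrightarrow> dm_star Sg \<Delta> \<Gamma> (DCase e A e1 A' e2) H \<epsilon> (Case u (star_ty A) v (star_ty A') w)"
| S_Return: "\<lbrakk>val_ty \<Delta> A; dm_star Sg \<Delta> \<Gamma> e A EffN u\<rbrakk>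
   \<Longrightarrow> dm_star Sg \<Delta> \<Gamma> (DReturn e) A EffTau
        (Lam (TFun (star_ty A) Type0) (App (Var 0) (lift 0 u)))"
| S_Bind: "\<lbrakk>dm_star Sg \<Delta> \<Gamma> e1 A EffTau u; dm_star Sg \<Delta> (A # \<Gamma>) e2 A' EffTau v\<rbrakk>
   \<Longrightarrow> dm_star Sg \<Delta> \<Gamma> (DBind e1 e2) A' EffTau
        (Lam (TFun (star_ty A') Type0)
          (App (lift 0 u) (Lam (star_ty A) (App (lift 1 v) (Var 1)))))"

lemma dm_typing_iff_dm_star:
  "dm_typing Sg \<Delta> \<Gamma> e H \<epsilon> \<longleftrightarrow> (\<exists>e'. dm_star Sg \<Delta> \<Gamma> e H \<epsilon> e')"
proof
  assume "dm_typing Sg \<Delta> \<Gamma> e H \<epsilon>"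
  then show "\<exists>e'. dm_star Sg \<Delta> \<Gamma> e H \<epsilon> e'"
  proof (induction rule: dm_typing.induct)
    case (T_Const \<Gamma> k bs b es)
    then have "\<forall>i. \<exists>e'. i < length bs \<longrightarrow> dm_star Sg \<Delta> \<Gamma> (es ! i) (DBase (bs ! i)) EffN e'"
      by blast
    then obtain f where
      f: "\<forall>i<length bs. dm_star Sg \<Delta> \<Gamma> (es ! i) (DBase (bs ! i)) EffN (f i)"
      by metis
    have "dm_star Sg \<Delta> \<Gamma> (DConst k es) (DBase b) EffN (Const k (map f [0..<length bs]))"
      using T_Const f by (intro S_Const[of \<Gamma> \<Delta> Sg k bs b es]) auto
    then show ?case by blast
  qed (blast intro: dm_star.intros)+
next
  assume "\<exists>e'. dm_star Sg \<Delta> \<Gamma> e H \<epsilon> e'"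
  then obtain e' where "dm_star Sg \<Delta> \<Gamma> e H \<epsilon> e'" ..
  then show "dm_typing Sg \<Delta> \<Gamma> e H \<epsilon>"
  proof (induction rule: dm_star.induct)
    case (S_Const \<Gamma> k bs b es es')
    then show ?case by (intro T_Const[of \<Gamma> \<Delta> Sg k bs b es]) auto
  qed (blast intro: dm_typing.intros)+
qed

end

theory Submission
  imports Defs
begin

text \<open>
  A logical relations argument inside the target logic: if the two copies \<open>x\<^sub>1\<close>, \<open>x\<^sub>2\<close> of each free
  variable satisfy \<open>x\<^sub>1 \<lesssim> x\<^sub>1\<close>, \<open>x\<^sub>1 \<lesssim> x\<^sub>2\<close> and \<open>x\<^sub>2 \<lesssim> x\<^sub>2\<close>, then \<open>u[x\<^sub>1] \<lesssim> u[x\<^sub>2]\<close> is derivable for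
  every term \<open>u\<close> built from the functional constructs of the target.  The relation is not
  reflexive, so all three hypotheses are carried along; in return each of the pairs \<open>(x\<^sub>1, x\<^sub>1)\<close>
  and \<open>(x\<^sub>2, x\<^sub>2)\<close> is again related, which supplies the side conditions of \<open>\<lesssim>\<close> at arrow types.  For
  a case analysis, \<open>a\<^sub>1 \<lesssim> a\<^sub>2\<close> only relates the two payloads to each other; that each is related
  to itself follows from \<open>a\<^sub>1 \<lesssim> a\<^sub>1\<close> and \<open>a\<^sub>2 \<lesssim> a\<^sub>2\<close> because the injections are injective and
  disjoint.  The translations of \<open>return\<close> and \<open>bind\<close> are composed of such constructs.
\<close>


section \<open>Renamings and simultaneous substitutions\<close>

definition up_ren :: "(nat \<Rightarrow> nat) \<Rightarrow> nat \<Rightarrow> nat" where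
  "up_ren r = case_nat 0 (\<lambda>i. Suc (r i))"

text \<open>\<open>lift\<close> and \<open>subst\<close> act at a single index, and commuting them
  under binders is index arithmetic. Renamings compose, so such laws become identities between
  functions on indices.\<close>

primrec ren :: "(nat \<Rightarrow> nat) \<Rightarrow> ('b, 'k) tm \<Rightarrow> ('b, 'k) tm" where
  "ren r (Var i) = Var (r i)"
| "ren r (App a b) = App (ren r a) (ren r b)"
| "ren r (Lam t a) = Lam t (ren (up_ren r) a)"
| "ren r (Const c as) = Const c (map (ren r) as)"
| "ren r (Pair a b) = Pair (ren r a) (ren r b)"
| "ren r (Fst a) = Fst (ren r a)"
| "ren r (Snd a) = Snd (ren r a)"
| "ren r (Inl a) = Inl (ren r a)"
| "ren r (Inr a) = Inr (ren r a)"
| "ren r (Case a s b t c) = Case (ren r a) s (ren (up_ren r) b) t (ren (up_ren r) c)"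
| "ren r Tru = Tru"
| "ren r Fls = Fls"
| "ren r (And a b) = And (ren r a) (ren r b)"
| "ren r (Or a b) = Or (ren r a) (ren r b)"
| "ren r (Imp a b) = Imp (ren r a) (ren r b)"
| "ren r (All t a) = All t (ren (up_ren r) a)"
| "ren r (Ex t a) = Ex t (ren (up_ren r) a)"
| "ren r (Eq t a b) = Eq t (ren r a) (ren r b)"

lemma up_ren_simps [simp]: "up_ren r 0 = 0" "up_ren r (Suc i) = Suc (r i)"
  by (simp_all add: up_ren_def)

lemma up_ren_comp: "up_ren r \<circ> up_ren s = up_ren (r \<circ> s)"
  by (auto simp: up_ren_def fun_eq_iff split: nat.split)

lemma ren_ren: "ren r (ren s a) = ren (r \<circ> s) a"
  by (induction a arbitrary: r s) (simp_all add: up_ren_comp)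

lemma lift_eq_ren: "lift k a = ren (\<lambda>i. if i < k then i else Suc i) a"
  by (induction a arbitrary: k)
    (auto simp: up_ren_def fun_eq_iff split: nat.split intro!: arg_cong2[where f = ren])

lemma lift0_eq_ren: "lift 0 a = ren Suc a"
  by (simp add: lift_eq_ren)

lemma ren_up_lift0 [simp]: "ren (up_ren r) (lift 0 a) = lift 0 (ren r a)"
  by (simp add: lift0_eq_ren ren_ren comp_def)

section \<open>Parallel substitution, with \<open>subst\<close> at every depth as an
  instance\<close>

definition up_sub :: "(nat \<Rightarrow> ('b, 'k) tm) \<Rightarrow> nat \<Rightarrow> ('b, 'k) tm" where
  "up_sub \<sigma> = case_nat (Var 0) (\<lambda>i. lift 0 (\<sigma> i))"

primrec msub :: "(nat \<Rightarrow> ('b, 'k) tm) \<Rightarrow> ('b, 'k) tm \<Rightarrow> ('b, 'k) tm" where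
  "msub \<sigma> (Var i) = \<sigma> i"
| "msub \<sigma> (App a b) = App (msub \<sigma> a) (msub \<sigma> b)"
| "msub \<sigma> (Lam t a) = Lam t (msub (up_sub \<sigma>) a)"
| "msub \<sigma> (Const c as) = Const c (map (msub \<sigma>) as)"
| "msub \<sigma> (Pair a b) = Pair (msub \<sigma> a) (msub \<sigma> b)"
| "msub \<sigma> (Fst a) = Fst (msub \<sigma> a)"
| "msub \<sigma> (Snd a) = Snd (msub \<sigma> a)"
| "msub \<sigma> (Inl a) = Inl (msub \<sigma> a)"
| "msub \<sigma> (Inr a) = Inr (msub \<sigma> a)"
| "msub \<sigma> (Case a s b t c) = Case (msub \<sigma> a) s (msub (up_sub \<sigma>) b) t (msub (up_sub \<sigma>) c)"
| "msub \<sigma> Tru = Tru"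
| "msub \<sigma> Fls = Fls"
| "msub \<sigma> (And a b) = And (msub \<sigma> a) (msub \<sigma> b)"
| "msub \<sigma> (Or a b) = Or (msub \<sigma> a) (msub \<sigma> b)"
| "msub \<sigma> (Imp a b) = Imp (msub \<sigma> a) (msub \<sigma> b)"
| "msub \<sigma> (All t a) = All t (msub (up_sub \<sigma>) a)"
| "msub \<sigma> (Ex t a) = Ex t (msub (up_sub \<sigma>) a)"
| "msub \<sigma> (Eq t a b) = Eq t (msub \<sigma> a) (msub \<sigma> b)"

lemma up_sub_simps [simp]: "up_sub \<sigma> 0 = Var 0" "up_sub \<sigma> (Suc i) = lift 0 (\<sigma> i)"
  by (simp_all add: up_sub_def)

lemma up_sub_ren: "up_sub (\<lambda>i. \<sigma> (r i)) = (\<lambda>i. up_sub \<sigma> (up_ren r i))"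
  by (auto simp: up_sub_def up_ren_def fun_eq_iff split: nat.split)

lemma msub_ren: "msub \<sigma> (ren r a) = msub (\<lambda>i. \<sigma> (r i)) a"
  by (induction a arbitrary: \<sigma> r) (simp_all add: up_sub_ren)

lemma ren_up_sub: "up_sub (\<lambda>i. ren r (\<sigma> i)) = (\<lambda>i. ren (up_ren r) (up_sub \<sigma> i))"
  by (auto simp: up_sub_def fun_eq_iff split: nat.split)

lemma ren_msub: "ren r (msub \<sigma> a) = msub (\<lambda>i. ren r (\<sigma> i)) a"
  by (induction a arbitrary: \<sigma> r) (simp_all add: ren_up_sub)

lemma up_sub_Var: "up_sub (\<lambda>i. Var (r i)) = (\<lambda>i. Var (up_ren r i))"
  by (auto simp: up_sub_def up_ren_def fun_eq_iff split: nat.split)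

lemma ren_eq_msub: "ren r a = msub (\<lambda>i. Var (r i)) a"
  by (induction a arbitrary: r) (simp_all add: up_sub_Var)

lemma subst_eq_msub:
  "subst k u a = msub (\<lambda>i. if i < k then Var i else if i = k then u else Var (i - 1)) a"
  by (induction a arbitrary: k u)
    (auto simp: up_sub_def fun_eq_iff split: nat.split intro!: arg_cong2[where f = msub])

lemma up_sub_id: "up_sub Var = Var"
  by (auto simp: up_sub_def fun_eq_iff split: nat.split)

lemma msub_Var [simp]: "msub Var a = a"
  by (induction a) (simp_all add: up_sub_id map_idI)

lemma subst0_lift0 [simp]: "subst 0 u (lift 0 a) = a"
  by (simp add: subst_eq_msub lift0_eq_ren msub_ren)

lemma msub_up_lift0 [simp]: "msub (up_sub \<sigma>) (lift 0 a) = lift 0 (msub \<sigma> a)"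
  by (simp add: lift0_eq_ren msub_ren ren_msub)

text \<open>For instantiating the outer of the two variables bound in \<open>stronger\<close>: one
  of the two lifts disappears, and the other goes with the inner variable.\<close>

lemma subst_lift2 [simp]: "subst (Suc 0) u (lift2 a) = lift 0 a"
  unfolding subst_eq_msub by (simp add: lift0_eq_ren ren_ren msub_ren) (simp add: ren_eq_msub)

lemma ren_subst0: "ren r (subst 0 u a) = subst 0 (ren r u) (ren (up_ren r) a)"
  unfolding subst_eq_msub ren_msub msub_ren
  by (auto simp: fun_eq_iff up_ren_def split: nat.split intro!: arg_cong2[where f = msub])

text \<open>A redex whose argument is a variable contracts to a renamed body. This lets the logical
  relation use renamings as environments instead of substitutions.\<close>

lemma subst0_ren_up: "subst 0 (Var j) (ren (up_ren r) a) = ren (case_nat j r) a"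
  unfolding subst_eq_msub msub_ren ren_eq_msub[of "case_nat j r"]
  by (auto simp: fun_eq_iff up_ren_def split: nat.split intro!: arg_cong2[where f = msub])

text \<open>For a case branch weakened by a slot for the scrutinee: under the branch binder that
  slot has index 1, and filling it changes nothing.\<close>

lemma subst_Suc_ren_up_Suc: "subst (Suc 0) u (ren (up_ren Suc) a) = a"
  unfolding subst_eq_msub msub_ren
  by (rule trans[OF arg_cong2[where f = msub, OF _ refl] msub_Var])
    (simp add: fun_eq_iff up_ren_def split: nat.split)

text \<open>All variables introduced by the formula are bound in it, and \<open>x\<close> and
  \<open>y\<close> occur below its binders only with matching lifts.\<close>

lemma msub_stronger: "msub \<sigma> (stronger t x y) = stronger t (msub \<sigma> x) (msub \<sigma> y)"
  by (induction t arbitrary: \<sigma> x y) simp_all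

lemma subst_stronger [simp]: "subst k u (stronger t x y) = stronger t (subst k u x) (subst k u y)"
  by (simp add: subst_eq_msub msub_stronger)

lemma ren_stronger [simp]: "ren r (stronger t x y) = stronger t (ren r x) (ren r y)"
  by (simp add: ren_eq_msub msub_stronger)

lemma lift_stronger [simp]: "lift k (stronger t x y) = stronger t (lift k x) (lift k y)"
  by (simp add: lift_eq_ren)


section \<open>Weakening\<close>

text \<open>Injectivity is not demanded: \<open>case_nat j r\<close> may send two variables to the
  same index.\<close>

definition ren_ok :: "'b ty list \<Rightarrow> (nat \<Rightarrow> nat) \<Rightarrow> 'b ty list \<Rightarrow> bool" where
  "ren_ok \<Gamma> r G \<longleftrightarrow> (\<forall>i<length \<Gamma>. r i < length G \<and> G ! r i = \<Gamma> ! i)"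

lemma ren_ok_up: "ren_ok \<Gamma> r G \<Longrightarrow> ren_ok (t # \<Gamma>) (up_ren r) (t # G)"
  by (auto simp: ren_ok_def up_ren_def split: nat.split)

lemma ren_ok_Suc: "ren_ok \<Gamma> Suc (t # \<Gamma>)"
  by (simp add: ren_ok_def)

lemma has_ty_ren:
  assumes "has_ty Sg D \<Gamma> a t" "ren_ok \<Gamma> r G"
  shows "has_ty Sg D G (ren r a) t"
  using assms
proof (induction arbitrary: r G rule: has_ty.induct)
  case (1 i \<Gamma>)
  then have "has_ty Sg D G (Var (r i)) (G ! r i)"
    by (intro has_ty.intros) (simp add: ren_ok_def)
  with 1 show ?case by (simp add: ren_ok_def)
next
  case (2 \<Gamma> f s t a)
  then have "has_ty Sg D G (ren r f) (TFun s t)" "has_ty Sg D G (ren r a) s" by simp_all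
  then show ?case by (simp add: has_ty.intros(2)[of _ _ _ _ s])
next
  case (10 \<Gamma> a s t b r' c)
  then have "has_ty Sg D G (ren r a) (TSum s t)" by simp
  with 10 show ?case by (auto intro!: has_ty.intros(10) 10 ren_ok_up)
qed (auto intro!: ren_ok_up intro: has_ty.intros)

lemma has_ty_Var: "i < length G \<Longrightarrow> G ! i = t \<Longrightarrow> has_ty Sg D G (Var i) t"
  using has_ty.intros(1) by blast

lemma has_ty_lift0: "has_ty Sg D G a t \<Longrightarrow> has_ty Sg D (s # G) (lift 0 a) t"
  by (simp add: lift0_eq_ren has_ty_ren ren_ok_Suc)

lemma has_ty_stronger:
  "\<lbrakk>wf_ty D t; has_ty Sg D G x t; has_ty Sg D G y t\<rbrakk> \<Longrightarrow> has_ty Sg D G (stronger t x y) Type0"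
proof (induction t arbitrary: G x y)
  case (TFun s t)
  have "has_ty Sg D (s # s # G) (App (lift2 x) (Var (Suc 0))) t"
    "has_ty Sg D (s # s # G) (App (lift2 y) (Var 0)) t"
    using TFun.prems by (auto intro!: has_ty.intros(2)[of _ _ _ _ s] has_ty_lift0 has_ty_Var)
  with TFun show ?case
    by (auto intro!: has_ty.intros(13-17) TFun.IH has_ty_Var)
next
  case (TProd s t)
  then show ?case
    by (auto intro!: has_ty.intros(13) TProd.IH intro: has_ty.intros(6,7))
next
  case (TSum s t)
  then show ?case
    by (auto intro!: has_ty.intros(13-18) TSum.IH has_ty.intros(8,9) has_ty_lift0 has_ty_Var)
qed (auto intro: has_ty.intros)

text \<open>Renaming and enlarging the hypotheses are done together. Inclusion of sets survives both
  the rules that add a hypothesis and those that lift the list under a binder.\<close>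

lemma valid_ren:
  assumes "valid Sg D G \<Phi> \<phi>" "ren_ok G r G'" "ren r ` set \<Phi> \<subseteq> set \<Phi>'"
  shows "valid Sg D G' \<Phi>' (ren r \<phi>)"
  using assms
proof (induction arbitrary: r G' \<Phi>' rule: valid.induct)
  case (V_OrE G \<Phi> \<phi> \<psi> \<chi>)
  show ?case
    by (rule valid.V_OrE[OF V_OrE.IH(1)[simplified, OF V_OrE.prems]
          V_OrE.IH(2)[OF V_OrE.prems(1)] V_OrE.IH(3)[OF V_OrE.prems(1)]])
      (use V_OrE.prems in auto)
next
  case (V_AllI t G \<Phi> \<phi>)
  show ?case
    by (simp, rule valid.V_AllI[OF V_AllI.hyps(1) V_AllI.IH[OF ren_ok_up[OF V_AllI.prems(1)]]])
      (use V_AllI.prems in auto)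
next
  case (V_AllE G \<Phi> t \<phi> a)
  then have "valid Sg D G' \<Phi>' (All t (ren (up_ren r) \<phi>))" by simp
  from valid.V_AllE[OF this] show ?case using V_AllE by (simp add: ren_subst0 has_ty_ren)
next
  case (V_ExI t G \<phi> a \<Phi>)
  show ?case
    by (simp, rule valid.V_ExI[OF V_ExI.hyps(1) has_ty_ren[OF V_ExI.hyps(2) ren_ok_up[OF V_ExI.prems(1)]]
          has_ty_ren[OF V_ExI.hyps(3) V_ExI.prems(1)]])
      (use V_ExI in \<open>simp add: ren_subst0\<close>)
next
  case (V_ExE G \<Phi> t \<phi> \<psi>)
  show ?case
  proof (rule valid.V_ExE)
    show "valid Sg D G' \<Phi>' (Ex t (ren (up_ren r) \<phi>))" using V_ExE by simp
    show "valid Sg D (t # G') (ren (up_ren r) \<phi> # map (lift 0) \<Phi>') (lift 0 (ren r \<psi>))"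
      using V_ExE.IH(2)[OF ren_ok_up[OF V_ExE.prems(1)], of "ren (up_ren r) \<phi> # map (lift 0) \<Phi>'"]
        V_ExE.prems(2) by (fastforce simp: image_subset_iff)
  qed
next
  case (V_Subst G \<Phi> t a b \<phi>)
  then have 1: "valid Sg D G' \<Phi>' (Eq t (ren r a) (ren r b))" by simp
  from V_Subst show ?case
    unfolding ren_subst0
    by (intro valid.V_Subst[OF 1 has_ty_ren[OF V_Subst.hyps(2) ren_ok_up[OF V_Subst.prems(1)]]])
      (auto simp: ren_subst0)
next
  case (V_Eta G f s t \<Phi>)
  then show ?case by (simp add: has_ty_ren valid.V_Eta)
next
  case (V_SumCases G a s t \<Phi> \<phi>)
  show ?case
  proof (rule valid.V_SumCases)
    show "has_ty Sg D G' (ren r a) (TSum s t)" using V_SumCases by (simp add: has_ty_ren)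
    show "valid Sg D (s # G') (Eq (TSum s t) (lift 0 (ren r a)) (Inl (Var 0)) # map (lift 0) \<Phi>') (lift 0 (ren r \<phi>))"
      using V_SumCases.IH(1)[OF ren_ok_up[OF V_SumCases.prems(1)],
          of "Eq (TSum s t) (lift 0 (ren r a)) (Inl (Var 0)) # map (lift 0) \<Phi>'"]
        V_SumCases.prems(2) by (fastforce simp: image_subset_iff)
    show "valid Sg D (t # G') (Eq (TSum s t) (lift 0 (ren r a)) (Inr (Var 0)) # map (lift 0) \<Phi>') (lift 0 (ren r \<phi>))"
      using V_SumCases.IH(2)[OF ren_ok_up[OF V_SumCases.prems(1)],
          of "Eq (TSum s t) (lift 0 (ren r a)) (Inr (Var 0)) # map (lift 0) \<Phi>'"]
        V_SumCases.prems(2) by (fastforce simp: image_subset_iff)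
  qed
next
  case (V_Hyp \<phi> \<Phi> G)
  then show ?case by (intro valid.V_Hyp) (auto intro: has_ty_ren)
next
  case (V_ImpI G \<phi> \<Phi> \<psi>)
  have "valid Sg D G' (ren r \<phi> # \<Phi>') (ren r \<psi>)"
    using V_ImpI.IH[OF V_ImpI.prems(1), of "ren r \<phi> # \<Phi>'"] V_ImpI.prems(2) by auto
  with V_ImpI show ?case by (simp add: valid.V_ImpI has_ty_ren)
next
  case (V_ImpE G \<Phi> \<phi> \<psi>)
  show ?case
    by (rule valid.V_ImpE[OF V_ImpE.IH(1)[simplified, OF V_ImpE.prems] V_ImpE.IH(2)[OF V_ImpE.prems]])
next
  case (V_Ext G f s t g \<Phi>)
  have "valid Sg D G' \<Phi>' (All s (Eq t (App (lift 0 (ren r f)) (Var 0)) (App (lift 0 (ren r g)) (Var 0))))"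
    using V_Ext.IH[OF V_Ext.prems] by simp
  with V_Ext show ?case by (simp add: valid.V_Ext has_ty_ren)
qed (auto simp: ren_subst0 intro: valid.intros has_ty_ren ren_ok_up)

lemma valid_lift2:
  assumes "valid Sg D G \<Phi> \<phi>" "lift2 ` set \<Phi> \<subseteq> set \<Phi>'"
  shows "valid Sg D (s # t # G) \<Phi>' (lift2 \<phi>)"
  using valid_ren[OF assms(1), of "Suc \<circ> Suc" "s # t # G" \<Phi>'] assms(2)
  by (simp add: lift0_eq_ren ren_ren ren_ok_def)


section \<open>Equality and its interaction with the relation\<close>

lemma valid_Eq_sym:
  assumes "valid Sg D G \<Phi> (Eq t a b)" "has_ty Sg D G a t"
  shows "valid Sg D G \<Phi> (Eq t b a)"
  \<comment> \<open>Leibniz substitution into the predicate of being equal to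
    \<open>a\<close>.\<close>
  using valid.V_Subst[OF assms(1), of "Eq t (Var 0) (lift 0 a)"] assms(2)
  by (simp add: valid.V_Refl has_ty.intros(18) has_ty_lift0 has_ty_Var)

lemma valid_Eq_trans:
  assumes "valid Sg D G \<Phi> (Eq t a b)" "valid Sg D G \<Phi> (Eq t b c)" "has_ty Sg D G a t"
  shows "valid Sg D G \<Phi> (Eq t a c)"
  using valid.V_Subst[OF assms(2), of "Eq t (lift 0 a) (Var 0)"] assms(1,3)
  by (simp add: has_ty.intros(18) has_ty_lift0 has_ty_Var)

text \<open>Here \<open>c\<close> is a term with a hole at index 0. The equation follows by
  rewriting the right-hand side of the reflexive equation at \<open>subst 0 a c\<close>.\<close>

lemma valid_Eq_cong:
  assumes "valid Sg D G \<Phi> (Eq s a b)" "has_ty Sg D (s # G) c t" "has_ty Sg D G (subst 0 a c) t"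
  shows "valid Sg D G \<Phi> (Eq t (subst 0 a c) (subst 0 b c))"
  using valid.V_Subst[OF assms(1), of "Eq t (lift 0 (subst 0 a c)) c"] assms(2,3)
  by (simp add: has_ty.intros(18) has_ty_lift0 valid.V_Refl)

text \<open>Formulas are themselves terms, so the predicate to substitute into can be the bare
  variable.\<close>

lemma valid_Eq_Type0:
  assumes "valid Sg D G \<Phi> (Eq Type0 p q)" "valid Sg D G \<Phi> p"
  shows "valid Sg D G \<Phi> q"
  using valid.V_Subst[OF assms(1), of "Var 0"] assms(2) by (simp add: has_ty_Var)

text \<open>The equations point from the new arguments to the old ones, the direction of reduction:
  a relation between reducts is carried back to redexes.\<close>

lemma valid_stronger_cong:
  assumes "valid Sg D G \<Phi> (Eq t a' a)" "valid Sg D G \<Phi> (Eq t b' b)"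
    and "has_ty Sg D G a' t" "has_ty Sg D G b' t" "has_ty Sg D G b t" "wf_ty D t"
    and "valid Sg D G \<Phi> (stronger t a b)"
  shows "valid Sg D G \<Phi> (stronger t a' b')"
proof -
  have "valid Sg D G \<Phi> (stronger t a' b)"
    using valid.V_Subst[OF valid_Eq_sym[OF assms(1)], of "stronger t (Var 0) (lift 0 b)"] assms
    by (simp add: has_ty_stronger has_ty_lift0 has_ty_Var)
  then show ?thesis
    using valid.V_Subst[OF valid_Eq_sym[OF assms(2)], of "stronger t (lift 0 a') (Var 0)"] assms
    by (simp add: has_ty_stronger has_ty_lift0 has_ty_Var)
qed

section \<open>Injectivity and disjointness of the injections\<close>

lemma valid_Inl_inject:
  assumes eq: "valid Sg D G \<Phi> (Eq (TSum s t) (Inl a) (Inl b))"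
    and a: "has_ty Sg D G a s" and b: "has_ty Sg D G b s" and t: "wf_ty D t"
  shows "valid Sg D G \<Phi> (Eq s a b)"
proof -
  have ty: "has_ty Sg D (r # G) (lift 0 a) s" for r
    using a by (rule has_ty_lift0)
  \<comment> \<open>A left inverse of \<open>Inl\<close>. Types may be empty, so the branch for the
    other summand needs a default of type \<open>s\<close>, and \<open>a\<close> serves.\<close>
  let ?c = "\<lambda>x. Case (Inl x) s (Var 0) t (lift 0 a)"
  have beta: "valid Sg D G \<Phi> (Eq s (?c x) x)" if "has_ty Sg D G x s" for x
    using valid.V_CaseInl[OF t that, of "Var 0" s "lift 0 a"] by (simp add: ty has_ty_Var)
  have tyc: "has_ty Sg D G (?c x) s" if "has_ty Sg D G x s" for x
    using that ty t by (intro has_ty.intros(10) has_ty.intros(8)) (auto intro: has_ty_Var)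
  \<comment> \<open>The same case term with a hole as scrutinee; the default now lies under the hole
    and the branch binder, hence two lifts.\<close>
  have "has_ty Sg D (TSum s t # G) (Case (Var 0) s (Var 0) t (lift2 a)) s"
    using ty by (intro has_ty.intros(10)) (auto intro: has_ty_Var has_ty_lift0)
  from valid_Eq_cong[OF eq this] have "valid Sg D G \<Phi> (Eq s (?c a) (?c b))"
    using tyc[OF a] by simp
  with beta a b tyc show ?thesis
    by (meson valid_Eq_sym valid_Eq_trans)
qed

lemma valid_Inr_inject:
  assumes eq: "valid Sg D G \<Phi> (Eq (TSum s t) (Inr a) (Inr b))"
    and a: "has_ty Sg D G a t" and b: "has_ty Sg D G b t" and s: "wf_ty D s"
  shows "valid Sg D G \<Phi> (Eq t a b)"
proof -
  have ty: "has_ty Sg D (r # G) (lift 0 a) t" for r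
    using a by (rule has_ty_lift0)
  let ?c = "\<lambda>x. Case (Inr x) s (lift 0 a) t (Var 0)"
  have beta: "valid Sg D G \<Phi> (Eq t (?c x) x)" if "has_ty Sg D G x t" for x
    using valid.V_CaseInr[OF s that, of "lift 0 a" t "Var 0"] by (simp add: ty has_ty_Var)
  have tyc: "has_ty Sg D G (?c x) t" if "has_ty Sg D G x t" for x
    using that ty s by (intro has_ty.intros(10) has_ty.intros(9)) (auto intro: has_ty_Var)
  have "has_ty Sg D (TSum s t # G) (Case (Var 0) s (lift2 a) t (Var 0)) t"
    using ty by (intro has_ty.intros(10)) (auto intro: has_ty_Var has_ty_lift0)
  from valid_Eq_cong[OF eq this] have "valid Sg D G \<Phi> (Eq t (?c a) (?c b))"
    using tyc[OF a] by simp
  with beta a b tyc show ?thesis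
    by (meson valid_Eq_sym valid_Eq_trans)
qed

lemma valid_Inl_Inr:
  assumes eq: "valid Sg D G \<Phi> (Eq (TSum s t) (Inl a) (Inr b))"
    and "has_ty Sg D G a s" "has_ty Sg D G b t" "wf_ty D s" "wf_ty D t"
    and "has_ty Sg D G \<phi> Type0"
  shows "valid Sg D G \<Phi> \<phi>"
proof -
  \<comment> \<open>A case analysis may return formulas: this discriminator is \<open>Tru\<close> on
    left and \<open>Fls\<close> on right injections.\<close>
  have c: "has_ty Sg D (TSum s t # G) (Case (Var 0) s Tru t Fls) Type0"
    by (intro has_ty.intros(10-12)) (simp add: has_ty_Var)
  have ca: "has_ty Sg D G (Case (Inl a) s Tru t Fls) Type0"
    using assms by (intro has_ty.intros(8,10-12))
  have l: "valid Sg D G \<Phi> (Eq Type0 (Case (Inl a) s Tru t Fls) Tru)"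
    using valid.V_CaseInl[OF assms(5,2), of Tru Type0 Fls] by (simp add: has_ty.intros)
  have r: "valid Sg D G \<Phi> (Eq Type0 (Case (Inr b) s Tru t Fls) Fls)"
    using valid.V_CaseInr[OF assms(4,3), of Tru Type0 Fls] by (simp add: has_ty.intros)
  have "valid Sg D G \<Phi> (Case (Inl a) s Tru t Fls)"
    using valid_Eq_Type0[OF valid_Eq_sym[OF l ca] valid.V_TruI] .
  moreover have "valid Sg D G \<Phi> (Eq Type0 (Case (Inl a) s Tru t Fls) (Case (Inr b) s Tru t Fls))"
    using valid_Eq_cong[OF eq c] ca by simp
  ultimately show ?thesis
    using r assms(6) by (meson valid_Eq_Type0 valid.V_FlsE)
qed

text \<open>\<open>V_Subst\<close> rewrites along one equation at a time, so the arguments are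
  exchanged one by one from the left.\<close>

lemma valid_Const_cong:
  assumes Sg: "Sg k = (bs, b)" and len: "length us = length bs" "length vs = length bs"
    and us: "\<forall>i<length bs. has_ty Sg D G (us ! i) (TBase (bs ! i))"
    and vs: "\<forall>i<length bs. has_ty Sg D G (vs ! i) (TBase (bs ! i))"
    and eq: "\<forall>i<length bs. valid Sg D G \<Phi> (Eq (TBase (bs ! i)) (us ! i) (vs ! i))"
  shows "valid Sg D G \<Phi> (Eq (TBase b) (Const k us) (Const k vs))"
proof -
  let ?m = "\<lambda>n. take n vs @ drop n us"
  have ty: "has_ty Sg D G (Const k (?m n)) (TBase b)" for n
    by (rule has_ty.intros(4)[of Sg k bs b]) (use Sg len us vs in \<open>auto simp: nth_append\<close>)
  have "valid Sg D G \<Phi> (Eq (TBase b) (Const k us) (Const k (?m n)))" if "n \<le> length bs" for n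
    using that
  proof (induction n)
    case 0
    show ?case using ty[of 0] by (simp add: valid.V_Refl)
  next
    case (Suc n)
    \<comment> \<open>The hole is at argument \<open>n\<close>: filled with \<open>us ! n\<close> it
      gives stage \<open>n\<close>, with \<open>vs ! n\<close> stage \<open>Suc n\<close>.\<close>
    let ?c = "Const k (map (lift 0) (take n vs) @ Var 0 # map (lift 0) (drop (Suc n) us))"
    have sub: "subst 0 (us ! n) ?c = Const k (?m n)" "subst 0 (vs ! n) ?c = Const k (?m (Suc n))"
      using Suc.prems len by (simp_all add: comp_def take_Suc_conv_app_nth Cons_nth_drop_Suc)
    have "has_ty Sg D (TBase (bs ! n) # G) ?c (TBase b)"
      by (rule has_ty.intros(4)[of Sg k bs b])
        (use Sg len us vs Suc.prems in
          \<open>auto simp: nth_append nth_Cons' min_def intro: has_ty_lift0 has_ty_Var\<close>)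
    from valid_Eq_cong[OF _ this, of \<Phi> "us ! n" "vs ! n"]
    have "valid Sg D G \<Phi> (Eq (TBase b) (Const k (?m n)) (Const k (?m (Suc n))))"
      using eq ty[of n] Suc.prems unfolding sub by simp
    with Suc ty[of 0] show ?case
      by (auto intro: valid_Eq_trans)
  qed
  from this[of "length bs"] show ?thesis using len by simp
qed


section \<open>Introduction and elimination rules for the relation\<close>

text \<open>The premise ranges over every \<open>\<Phi>'\<close> that extends the lifted hypotheses
  and derives the three relations, so that users never handle the concrete hypothesis list.\<close>

lemma valid_stronger_TFunI:
  assumes s: "wf_ty D s"
    and body: "\<And>\<Phi>'. \<lbrakk>lift2 ` set \<Phi> \<subseteq> set \<Phi>'; valid Sg D (s # s # G) \<Phi>' (stronger s (Var 1) (Var 1));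
      valid Sg D (s # s # G) \<Phi>' (stronger s (Var 1) (Var 0));
      valid Sg D (s # s # G) \<Phi>' (stronger s (Var 0) (Var 0))\<rbrakk>
      \<Longrightarrow> valid Sg D (s # s # G) \<Phi>' (stronger t (App (lift2 f) (Var 1)) (App (lift2 g) (Var 0)))"
  shows "valid Sg D G \<Phi> (stronger (TFun s t) f g)"
proof -
  let ?h = "And (stronger s (Var 1) (Var 1)) (And (stronger s (Var 1) (Var 0)) (stronger s (Var 0) (Var 0)))"
  let ?\<Phi> = "?h # map (lift 0) (map (lift 0) \<Phi>)"
  have ty: "has_ty Sg D (s # s # G) ?h Type0"
    using s by (intro has_ty.intros(13) has_ty_stronger has_ty_Var) auto
  then have h: "valid Sg D (s # s # G) ?\<Phi> ?h"
    by (intro valid.V_Hyp) auto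
  have "valid Sg D (s # s # G) ?\<Phi> (stronger t (App (lift2 f) (Var 1)) (App (lift2 g) (Var 0)))"
    by (rule body[OF _ valid.V_AndE1[OF h] valid.V_AndE1[OF valid.V_AndE2[OF h]]
          valid.V_AndE2[OF valid.V_AndE2[OF h]]]) auto
  then show ?thesis
    unfolding stronger.simps by (intro valid.V_AllI[OF s] valid.V_ImpI[OF ty])
qed

lemma valid_stronger_TFunE:
  assumes f: "valid Sg D G \<Phi> (stronger (TFun s t) f g)"
    and ab: "has_ty Sg D G a s" "has_ty Sg D G b s"
    and "valid Sg D G \<Phi> (stronger s a a)" "valid Sg D G \<Phi> (stronger s a b)"
      "valid Sg D G \<Phi> (stronger s b b)"
  shows "valid Sg D G \<Phi> (stronger t (App f a) (App g b))"
  using valid.V_AllE[OF valid.V_AllE[OF f[unfolded stronger.simps] ab(1), simplified subst.simps] ab(2)] assms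
  by (auto intro: valid.V_ImpE valid.V_AndI)

section \<open>Introduction and elimination at sum types\<close>

lemma valid_Ex2E:
  assumes ex: "valid Sg D G \<Phi> (Ex s (Ex s \<phi>))" and s: "wf_ty D s"
    and ty: "has_ty Sg D (s # s # G) \<phi> Type0"
    and body: "\<And>\<Phi>'. \<lbrakk>lift2 ` set \<Phi> \<subseteq> set \<Phi>'; valid Sg D (s # s # G) \<Phi>' \<phi>\<rbrakk>
      \<Longrightarrow> valid Sg D (s # s # G) \<Phi>' (lift2 \<psi>)"
  shows "valid Sg D G \<Phi> \<psi>"
proof (rule valid.V_ExE[OF ex], rule valid.V_ExE)
  show "valid Sg D (s # G) (Ex s \<phi> # map (lift 0) \<Phi>) (Ex s \<phi>)"
    using s ty by (intro valid.V_Hyp has_ty.intros(17)) auto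
  \<comment> \<open>The lifted intermediate hypothesis \<open>Ex s \<phi>\<close> is still in the
    list, which is why \<open>body\<close> asks only for an inclusion.\<close>
  show "valid Sg D (s # s # G) (\<phi> # map (lift 0) (Ex s \<phi> # map (lift 0) \<Phi>)) (lift2 \<psi>)"
    by (rule body) (use ty in \<open>auto intro: valid.V_Hyp\<close>)
qed

text \<open>The outer witness \<open>a\<close> goes in first, at index 1 and lifted past the binder
  that remains; then \<open>b\<close> fills index 0.\<close>

lemma valid_Ex2I:
  assumes "wf_ty D s" "has_ty Sg D (s # s # G) \<phi> Type0"
    and "has_ty Sg D G a s" "has_ty Sg D G b s"
    and "has_ty Sg D (s # G) (subst (Suc 0) (lift 0 a) \<phi>) Type0"
    and "valid Sg D G \<Phi> (subst 0 b (subst (Suc 0) (lift 0 a) \<phi>))"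
  shows "valid Sg D G \<Phi> (Ex s (Ex s \<phi>))"
  using assms by (intro valid.V_ExI[of _ s _ _ _ a] has_ty.intros(17)) (auto intro: valid.V_ExI)

text \<open>Here \<open>In\<close> is \<open>Inl\<close> or \<open>Inr\<close>, and \<open>r\<close> is the summand \<open>s\<close> or \<open>t\<close> accordingly.\<close>

definition inj_matrix ::
  "(('b, 'k) tm \<Rightarrow> ('b, 'k) tm) \<Rightarrow> 'b ty \<Rightarrow> 'b ty \<Rightarrow> 'b ty \<Rightarrow> ('b, 'k) tm \<Rightarrow> ('b, 'k) tm \<Rightarrow> ('b, 'k) tm" where
  "inj_matrix In r s t x y = And (Eq (TSum s t) x (In (Var 1)))
     (And (Eq (TSum s t) y (In (Var 0))) (stronger r (Var 1) (Var 0)))"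

lemma stronger_TSum:
  "stronger (TSum s t) x y = Or (Ex s (Ex s (inj_matrix Inl s s t (lift2 x) (lift2 y))))
     (Ex t (Ex t (inj_matrix Inr t s t (lift2 x) (lift2 y))))"
  by (simp add: inj_matrix_def)

lemma has_ty_inj_matrix:
  assumes "has_ty Sg D (r # r # G) x (TSum s t)" "has_ty Sg D (r # r # G) y (TSum s t)"
    and "\<And>a. has_ty Sg D (r # r # G) a r \<Longrightarrow> has_ty Sg D (r # r # G) (In a) (TSum s t)" "wf_ty D r"
  shows "has_ty Sg D (r # r # G) (inj_matrix In r s t x y) Type0"
  unfolding inj_matrix_def
  by (intro has_ty.intros(13,18) has_ty_stronger) (auto intro!: assms has_ty_Var)

lemma valid_stronger_TSumE:
  assumes sum: "valid Sg D G \<Phi> (stronger (TSum s t) x y)"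
    and ty: "has_ty Sg D G x (TSum s t)" "has_ty Sg D G y (TSum s t)" "wf_ty D s" "wf_ty D t"
    and l: "\<And>\<Phi>'. \<lbrakk>lift2 ` set \<Phi> \<subseteq> set \<Phi>'; valid Sg D (s # s # G) \<Phi>' (Eq (TSum s t) (lift2 x) (Inl (Var 1)));
      valid Sg D (s # s # G) \<Phi>' (Eq (TSum s t) (lift2 y) (Inl (Var 0)));
      valid Sg D (s # s # G) \<Phi>' (stronger s (Var 1) (Var 0))\<rbrakk>
      \<Longrightarrow> valid Sg D (s # s # G) \<Phi>' (lift2 \<psi>)"
    and r: "\<And>\<Phi>'. \<lbrakk>lift2 ` set \<Phi> \<subseteq> set \<Phi>'; valid Sg D (t # t # G) \<Phi>' (Eq (TSum s t) (lift2 x) (Inr (Var 1)));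
      valid Sg D (t # t # G) \<Phi>' (Eq (TSum s t) (lift2 y) (Inr (Var 0)));
      valid Sg D (t # t # G) \<Phi>' (stronger t (Var 1) (Var 0))\<rbrakk>
      \<Longrightarrow> valid Sg D (t # t # G) \<Phi>' (lift2 \<psi>)"
  shows "valid Sg D G \<Phi> \<psi>"
proof (rule valid.V_OrE[OF sum[unfolded stronger_TSum]])
  let ?l = "inj_matrix Inl s s t (lift2 x) (lift2 y)" and ?r = "inj_matrix Inr t s t (lift2 x) (lift2 y)"
  have tl: "has_ty Sg D (s # s # G) ?l Type0" and tr: "has_ty Sg D (t # t # G) ?r Type0"
    using ty by (auto intro!: has_ty_inj_matrix has_ty_lift0 has_ty.intros(8,9))
  show "valid Sg D G (Ex s (Ex s ?l) # \<Phi>) \<psi>"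
  proof (rule valid_Ex2E[OF _ ty(3) tl])
    show "valid Sg D G (Ex s (Ex s ?l) # \<Phi>) (Ex s (Ex s ?l))"
      using tl ty by (intro valid.V_Hyp has_ty.intros(17)) auto
  qed (rule l, auto simp: inj_matrix_def dest: valid.V_AndE1 valid.V_AndE2)
  show "valid Sg D G (Ex t (Ex t ?r) # \<Phi>) \<psi>"
  proof (rule valid_Ex2E[OF _ ty(4) tr])
    show "valid Sg D G (Ex t (Ex t ?r) # \<Phi>) (Ex t (Ex t ?r))"
      using tr ty by (intro valid.V_Hyp has_ty.intros(17)) auto
  qed (rule r, auto simp: inj_matrix_def dest: valid.V_AndE1 valid.V_AndE2)
qed

lemma valid_stronger_Inl:
  assumes "valid Sg D G \<Phi> (stronger s a b)" "has_ty Sg D G a s" "has_ty Sg D G b s"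
    and "wf_ty D s" "wf_ty D t"
  shows "valid Sg D G \<Phi> (stronger (TSum s t) (Inl a) (Inl b))"
proof -
  have tl: "has_ty Sg D (s # s # G) (inj_matrix Inl s s t (lift2 (Inl a)) (lift2 (Inl b))) Type0"
    and tr: "has_ty Sg D (t # t # G) (inj_matrix Inr t s t (lift2 (Inl a)) (lift2 (Inl b))) Type0"
    using assms by (auto intro!: has_ty_inj_matrix has_ty_lift0 has_ty.intros(8,9))
  \<comment> \<open>The witnesses are \<open>a\<close> and \<open>b\<close> themselves, so both
    equations hold by reflexivity.\<close>
  have "valid Sg D G \<Phi> (Ex s (Ex s (inj_matrix Inl s s t (lift2 (Inl a)) (lift2 (Inl b)))))"
    by (rule valid_Ex2I[OF assms(4) tl assms(2,3)])
      (use assms in \<open>auto simp: inj_matrix_def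
        intro!: valid.V_AndI valid.V_Refl has_ty.intros(8,13,18) has_ty_stronger has_ty_lift0 has_ty_Var\<close>)
  then show ?thesis
    unfolding stronger_TSum using tr assms by (intro valid.V_OrI1 has_ty.intros(17))
qed

lemma valid_stronger_Inr:
  assumes "valid Sg D G \<Phi> (stronger t a b)" "has_ty Sg D G a t" "has_ty Sg D G b t"
    and "wf_ty D s" "wf_ty D t"
  shows "valid Sg D G \<Phi> (stronger (TSum s t) (Inr a) (Inr b))"
proof -
  have tl: "has_ty Sg D (s # s # G) (inj_matrix Inl s s t (lift2 (Inr a)) (lift2 (Inr b))) Type0"
    and tr: "has_ty Sg D (t # t # G) (inj_matrix Inr t s t (lift2 (Inr a)) (lift2 (Inr b))) Type0"
    using assms by (auto intro!: has_ty_inj_matrix has_ty_lift0 has_ty.intros(8,9))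
  have "valid Sg D G \<Phi> (Ex t (Ex t (inj_matrix Inr t s t (lift2 (Inr a)) (lift2 (Inr b)))))"
    by (rule valid_Ex2I[OF assms(5) tr assms(2,3)])
      (use assms in \<open>auto simp: inj_matrix_def
        intro!: valid.V_AndI valid.V_Refl has_ty.intros(9,13,18) has_ty_stronger has_ty_lift0 has_ty_Var\<close>)
  then show ?thesis
    unfolding stronger_TSum using tl assms by (intro valid.V_OrI2 has_ty.intros(17))
qed

text \<open>Relatedness of \<open>x\<close> to itself yields two related payloads, possibly distinct
  variables. Injectivity equates both with \<open>a\<close>, and the disjunct for the other summand
  contradicts disjointness.\<close>

lemma valid_stronger_refl_Inl:
  assumes "valid Sg D G \<Phi> (stronger (TSum s t) x x)" and eq: "valid Sg D G \<Phi> (Eq (TSum s t) x (Inl a))"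
    and x: "has_ty Sg D G x (TSum s t)" and a: "has_ty Sg D G a s" and wf: "wf_ty D s" "wf_ty D t"
  shows "valid Sg D G \<Phi> (stronger s a a)"
proof (rule valid_stronger_TSumE[OF assms(1) x x wf])
  fix \<Phi>' assume P: "lift2 ` set \<Phi> \<subseteq> set \<Phi>'"
    and h: "valid Sg D (s # s # G) \<Phi>' (Eq (TSum s t) (lift2 x) (Inl (Var 1)))"
      "valid Sg D (s # s # G) \<Phi>' (Eq (TSum s t) (lift2 x) (Inl (Var 0)))"
      "valid Sg D (s # s # G) \<Phi>' (stronger s (Var 1) (Var 0))"
  have ty: "has_ty Sg D (s # s # G) (lift2 x) (TSum s t)" "has_ty Sg D (s # s # G) (lift2 a) s"
    "has_ty Sg D (s # s # G) (Inl (lift2 a)) (TSum s t)"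
    using x a wf by (auto intro: has_ty_lift0 has_ty.intros(8))
  have e: "valid Sg D (s # s # G) \<Phi>' (Eq (TSum s t) (Inl (lift2 a)) (lift2 x))"
    using valid_lift2[OF eq P] ty by (auto intro: valid_Eq_sym)
  have inj: "valid Sg D (s # s # G) \<Phi>' (Eq s (lift2 a) (Var j))"
    if "valid Sg D (s # s # G) \<Phi>' (Eq (TSum s t) (lift2 x) (Inl (Var j)))" "j < 2" for j
  proof -
    have "has_ty Sg D (s # s # G) (Var j) s"
      using that(2) by (auto intro: has_ty_Var simp: less_2_cases_iff)
    then show ?thesis
      using valid_Inl_inject[OF valid_Eq_trans[OF e that(1) ty(3)] ty(2) _ wf(2)] by blast
  qed
  show "valid Sg D (s # s # G) \<Phi>' (lift2 (stronger s a a))"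
    using valid_stronger_cong[OF inj[OF h(1)] inj[OF h(2)] ty(2) ty(2) _ wf(1) h(3)]
    by (simp add: has_ty_Var)
next
  fix \<Phi>' assume P: "lift2 ` set \<Phi> \<subseteq> set \<Phi>'"
    and h: "valid Sg D (t # t # G) \<Phi>' (Eq (TSum s t) (lift2 x) (Inr (Var 1)))"
  have ty: "has_ty Sg D (t # t # G) (lift2 x) (TSum s t)" "has_ty Sg D (t # t # G) (lift2 a) s"
    "has_ty Sg D (t # t # G) (Inl (lift2 a)) (TSum s t)"
    using x a wf by (auto intro: has_ty_lift0 has_ty.intros(8))
  have e: "valid Sg D (t # t # G) \<Phi>' (Eq (TSum s t) (Inl (lift2 a)) (lift2 x))"
    using valid_lift2[OF eq P] ty by (auto intro: valid_Eq_sym)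
  show "valid Sg D (t # t # G) \<Phi>' (lift2 (stronger s a a))"
    by (rule valid_Inl_Inr[OF valid_Eq_trans[OF e h ty(3)] ty(2) _ wf])
      (use ty wf in \<open>auto intro: has_ty_Var has_ty_stronger\<close>)
qed

lemma valid_stronger_refl_Inr:
  assumes "valid Sg D G \<Phi> (stronger (TSum s t) x x)" and eq: "valid Sg D G \<Phi> (Eq (TSum s t) x (Inr a))"
    and x: "has_ty Sg D G x (TSum s t)" and a: "has_ty Sg D G a t" and wf: "wf_ty D s" "wf_ty D t"
  shows "valid Sg D G \<Phi> (stronger t a a)"
proof (rule valid_stronger_TSumE[OF assms(1) x x wf])
  fix \<Phi>' assume P: "lift2 ` set \<Phi> \<subseteq> set \<Phi>'"
    and h: "valid Sg D (t # t # G) \<Phi>' (Eq (TSum s t) (lift2 x) (Inr (Var 1)))"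
      "valid Sg D (t # t # G) \<Phi>' (Eq (TSum s t) (lift2 x) (Inr (Var 0)))"
      "valid Sg D (t # t # G) \<Phi>' (stronger t (Var 1) (Var 0))"
  have ty: "has_ty Sg D (t # t # G) (lift2 x) (TSum s t)" "has_ty Sg D (t # t # G) (lift2 a) t"
    "has_ty Sg D (t # t # G) (Inr (lift2 a)) (TSum s t)"
    using x a wf by (auto intro: has_ty_lift0 has_ty.intros(9))
  have e: "valid Sg D (t # t # G) \<Phi>' (Eq (TSum s t) (Inr (lift2 a)) (lift2 x))"
    using valid_lift2[OF eq P] ty by (auto intro: valid_Eq_sym)
  have inj: "valid Sg D (t # t # G) \<Phi>' (Eq t (lift2 a) (Var j))"
    if "valid Sg D (t # t # G) \<Phi>' (Eq (TSum s t) (lift2 x) (Inr (Var j)))" "j < 2" for j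
  proof -
    have "has_ty Sg D (t # t # G) (Var j) t"
      using that(2) by (auto intro: has_ty_Var simp: less_2_cases_iff)
    then show ?thesis
      using valid_Inr_inject[OF valid_Eq_trans[OF e that(1) ty(3)] ty(2) _ wf(1)] by blast
  qed
  show "valid Sg D (t # t # G) \<Phi>' (lift2 (stronger t a a))"
    using valid_stronger_cong[OF inj[OF h(1)] inj[OF h(2)] ty(2) ty(2) _ wf(2) h(3)]
    by (simp add: has_ty_Var)
next
  fix \<Phi>' assume P: "lift2 ` set \<Phi> \<subseteq> set \<Phi>'"
    and h: "valid Sg D (s # s # G) \<Phi>' (Eq (TSum s t) (lift2 x) (Inl (Var 1)))"
  have ty: "has_ty Sg D (s # s # G) (lift2 x) (TSum s t)" "has_ty Sg D (s # s # G) (lift2 a) t"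
    "has_ty Sg D (s # s # G) (Inl (Var 1)) (TSum s t)"
    using x a wf by (auto intro!: has_ty_lift0 has_ty_Var has_ty.intros(8))
  \<comment> \<open>Disjointness is stated with \<open>Inl\<close> on the left, so here the chain
    starts from the payload equation and ends in \<open>Inr (lift2 a)\<close>.\<close>
  have e: "valid Sg D (s # s # G) \<Phi>' (Eq (TSum s t) (Inl (Var 1)) (lift2 x))"
    using valid_Eq_sym[OF h ty(1)] .
  have e': "valid Sg D (s # s # G) \<Phi>' (Eq (TSum s t) (lift2 x) (Inr (lift2 a)))"
    using valid_lift2[OF eq P] by simp
  show "valid Sg D (s # s # G) \<Phi>' (lift2 (stronger t a a))"
    by (rule valid_Inl_Inr[OF valid_Eq_trans[OF e e' ty(3)] _ ty(2) wf])
      (use ty wf in \<open>auto intro: has_ty_Var has_ty_stronger\<close>)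
qed


section \<open>Monotone terms\<close>

text \<open>
  The environments of the logical relation are pairs of renamings: the two instances of the
  translated term live in one context that holds both copies of each variable.
\<close>

definition rel_env ::
  "('k, 'b) signature \<Rightarrow> 'b tctx \<Rightarrow> 'b ty list \<Rightarrow> ('b, 'k) tm list \<Rightarrow> 'b ty list
    \<Rightarrow> (nat \<Rightarrow> nat) \<Rightarrow> (nat \<Rightarrow> nat) \<Rightarrow> bool" where
  "rel_env Sg D G \<Phi> \<Gamma> r1 r2 \<longleftrightarrow> ren_ok \<Gamma> r1 G \<and> ren_ok \<Gamma> r2 G \<and>
     (\<forall>i<length \<Gamma>. valid Sg D G \<Phi> (stronger (\<Gamma> ! i) (Var (r1 i)) (Var (r1 i))) \<and>
       valid Sg D G \<Phi> (stronger (\<Gamma> ! i) (Var (r1 i)) (Var (r2 i))) \<and>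
       valid Sg D G \<Phi> (stronger (\<Gamma> ! i) (Var (r2 i)) (Var (r2 i))))"

text \<open>Quantifying over all \<open>G\<close> and \<open>\<Phi>\<close> gives the relation a
  Kripke form: the body of a binder can be used in a larger context with more hypotheses. Typing is
  included because the derivation rules ask for it.\<close>

definition monotone_tm ::
  "('k, 'b) signature \<Rightarrow> 'b tctx \<Rightarrow> 'b ty list \<Rightarrow> ('b, 'k) tm \<Rightarrow> 'b ty \<Rightarrow> bool" where
  "monotone_tm Sg D \<Gamma> u t \<longleftrightarrow> wf_ty D t \<and> has_ty Sg D \<Gamma> u t \<and>
     (\<forall>G \<Phi> r1 r2. rel_env Sg D G \<Phi> \<Gamma> r1 r2 \<longrightarrow> valid Sg D G \<Phi> (stronger t (ren r1 u) (ren r2 u)))"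

text \<open>The point of keeping three relations per variable: both diagonal pairs are again
  environments, so each instance of a monotone term is related to itself.\<close>

lemma rel_env_refl:
  assumes "rel_env Sg D G \<Phi> \<Gamma> r1 r2"
  shows "rel_env Sg D G \<Phi> \<Gamma> r1 r1" "rel_env Sg D G \<Phi> \<Gamma> r2 r2"
  using assms by (auto simp: rel_env_def)

lemma rel_env_lift2:
  assumes "rel_env Sg D G \<Phi> \<Gamma> r1 r2" "lift2 ` set \<Phi> \<subseteq> set \<Phi>'"
  shows "rel_env Sg D (s # t # G) \<Phi>' \<Gamma> (Suc \<circ> Suc \<circ> r1) (Suc \<circ> Suc \<circ> r2)"
proof -
  have "valid Sg D (s # t # G) \<Phi>' (stronger a (Var (Suc (Suc i))) (Var (Suc (Suc j))))"
    if "valid Sg D G \<Phi> (stronger a (Var i) (Var j))" for a i j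
    using valid_lift2[OF that assms(2)] by simp
  then show ?thesis
    using assms(1) by (auto simp: rel_env_def ren_ok_def)
qed

lemma rel_env_Cons:
  assumes "rel_env Sg D G \<Phi> \<Gamma> r1 r2" "i < length G" "j < length G" "G ! i = s" "G ! j = s"
    and "valid Sg D G \<Phi> (stronger s (Var i) (Var i))" "valid Sg D G \<Phi> (stronger s (Var i) (Var j))"
      "valid Sg D G \<Phi> (stronger s (Var j) (Var j))"
  shows "rel_env Sg D G \<Phi> (s # \<Gamma>) (case_nat i r1) (case_nat j r2)"
  using assms by (auto simp: rel_env_def nth_Cons ren_ok_def split: nat.split)

text \<open>Precomposing both environments with \<open>r\<close> suffices. This handles the lifted
  subterms in the translations of \<open>return\<close> and \<open>bind\<close>.\<close>

lemma monotone_tm_ren: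
  assumes "monotone_tm Sg D \<Gamma> u t" "ren_ok \<Gamma> r \<Gamma>'"
  shows "monotone_tm Sg D \<Gamma>' (ren r u) t"
proof -
  have "rel_env Sg D G \<Phi> \<Gamma> (r1 \<circ> r) (r2 \<circ> r)" if "rel_env Sg D G \<Phi> \<Gamma>' r1 r2" for G \<Phi> r1 r2
    using that assms(2) unfolding rel_env_def ren_ok_def comp_apply by metis
  then show ?thesis
    using assms by (auto simp: monotone_tm_def ren_ren intro: has_ty_ren)
qed

lemma monotone_Var: "i < length \<Gamma> \<Longrightarrow> wf_ty D (\<Gamma> ! i) \<Longrightarrow> monotone_tm Sg D \<Gamma> (Var i) (\<Gamma> ! i)"
  by (auto simp: monotone_tm_def rel_env_def intro: has_ty.intros(1))

text \<open>At base types the relation is equality, so congruence of constants is all that is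
  required.\<close>

lemma monotone_Const:
  assumes "Sg k = (bs, b)" "length us = length bs"
    and us: "\<forall>i<length bs. monotone_tm Sg D \<Gamma> (us ! i) (TBase (bs ! i))"
  shows "monotone_tm Sg D \<Gamma> (Const k us) (TBase b)"
proof -
  have "has_ty Sg D \<Gamma> (Const k us) (TBase b)"
    using assms by (intro has_ty.intros(4)[of Sg k bs b]) (auto simp: monotone_tm_def)
  moreover have "valid Sg D G \<Phi> (Eq (TBase b) (Const k (map (ren r1) us)) (Const k (map (ren r2) us)))"
    if r: "rel_env Sg D G \<Phi> \<Gamma> r1 r2" for G \<Phi> r1 r2
    using assms r
    by (intro valid_Const_cong[of Sg k bs b]) (auto simp: monotone_tm_def rel_env_def intro: has_ty_ren)
  ultimately show ?thesis by (simp add: monotone_tm_def)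
qed

lemma valid_beta_ren:
  assumes "wf_ty D s" "has_ty Sg D (s # \<Gamma>) u t" "ren_ok \<Gamma> r G" "j < length G" "G ! j = s"
  shows "valid Sg D G \<Phi> (Eq t (App (ren r (Lam s u)) (Var j)) (ren (case_nat j r) u))"
  using valid.V_Beta[of D s Sg G "ren (up_ren r) u" t "Var j" \<Phi>] assms
  by (simp add: subst0_ren_up has_ty_ren ren_ok_up has_ty_Var)

lemma lift2_ren: "lift2 (ren r a) = ren (Suc \<circ> Suc \<circ> r) a"
  by (simp add: lift0_eq_ren ren_ren comp_assoc)

lemma monotone_Lam:
  assumes s: "wf_ty D s" and u: "monotone_tm Sg D (s # \<Gamma>) u t"
  shows "monotone_tm Sg D \<Gamma> (Lam s u) (TFun s t)"
proof -
  have t: "wf_ty D t" and ut: "has_ty Sg D (s # \<Gamma>) u t"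
    using u by (auto simp: monotone_tm_def)
  have ty: "has_ty Sg D \<Gamma> (Lam s u) (TFun s t)"
    using s ut by (rule has_ty.intros(3))
  have "valid Sg D G \<Phi> (stronger (TFun s t) (ren r1 (Lam s u)) (ren r2 (Lam s u)))"
    if r: "rel_env Sg D G \<Phi> \<Gamma> r1 r2" for G \<Phi> r1 r2
  proof (rule valid_stronger_TFunI[OF s])
    fix \<Phi>' assume P: "lift2 ` set \<Phi> \<subseteq> set \<Phi>'"
      and h: "valid Sg D (s # s # G) \<Phi>' (stronger s (Var 1) (Var 1))"
        "valid Sg D (s # s # G) \<Phi>' (stronger s (Var 1) (Var 0))"
        "valid Sg D (s # s # G) \<Phi>' (stronger s (Var 0) (Var 0))"
    let ?r1 = "Suc \<circ> Suc \<circ> r1" and ?r2 = "Suc \<circ> Suc \<circ> r2"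
    have r': "rel_env Sg D (s # s # G) \<Phi>' \<Gamma> ?r1 ?r2"
      using rel_env_lift2[OF r P] .
    then have ok: "ren_ok \<Gamma> ?r1 (s # s # G)" "ren_ok \<Gamma> ?r2 (s # s # G)"
      by (auto simp: rel_env_def)
    \<comment> \<open>The first copy of the bound variable is quantified outermost, so it has index
      1 and the second copy index 0.\<close>
    have r'': "rel_env Sg D (s # s # G) \<Phi>' (s # \<Gamma>) (case_nat 1 ?r1) (case_nat 0 ?r2)"
      using h by (intro rel_env_Cons[OF r']) auto
    then have c: "valid Sg D (s # s # G) \<Phi>' (stronger t (ren (case_nat 1 ?r1) u) (ren (case_nat 0 ?r2) u))"
      using u by (simp add: monotone_tm_def)
    have a: "has_ty Sg D (s # s # G) (App (ren q (Lam s u)) (Var j)) t"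
      if "ren_ok \<Gamma> q (s # s # G)" "(s # s # G) ! j = s" "j < Suc (Suc (length G))" for q j
      using that has_ty_ren[OF ty that(1)] by (intro has_ty.intros(2)[of _ _ _ _ s]) (auto intro: has_ty_Var)
    show "valid Sg D (s # s # G) \<Phi>'
       (stronger t (App (lift2 (ren r1 (Lam s u))) (Var 1)) (App (lift2 (ren r2 (Lam s u))) (Var 0)))"
      \<comment> \<open>Both applications beta-reduce to the body in the extended environments,
        where \<open>c\<close> relates them.\<close>
      unfolding lift2_ren
      by (rule valid_stronger_cong[OF valid_beta_ren[OF s ut ok(1)] valid_beta_ren[OF s ut ok(2)] _ _ _ t c])
        (use a ok r'' ut in \<open>auto simp: rel_env_def simp del: ren.simps intro: has_ty_ren\<close>)
  qed
  with ty s t show ?thesis by (simp add: monotone_tm_def del: ren.simps stronger.simps)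
qed

lemma monotone_App:
  assumes f: "monotone_tm Sg D \<Gamma> f (TFun s t)" and a: "monotone_tm Sg D \<Gamma> a s"
  shows "monotone_tm Sg D \<Gamma> (App f a) t"
proof -
  have "valid Sg D G \<Phi> (stronger t (App (ren r1 f) (ren r1 a)) (App (ren r2 f) (ren r2 a)))"
    if r: "rel_env Sg D G \<Phi> \<Gamma> r1 r2" for G \<Phi> r1 r2
  proof (rule valid_stronger_TFunE)
    show "valid Sg D G \<Phi> (stronger (TFun s t) (ren r1 f) (ren r2 f))"
      using f r by (simp add: monotone_tm_def del: stronger.simps)
    show "has_ty Sg D G (ren r1 a) s" "has_ty Sg D G (ren r2 a) s"
      using a r by (auto simp: monotone_tm_def rel_env_def intro: has_ty_ren)
    \<comment> \<open>The two self-relations come from the diagonal environments.\<close>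
    show "valid Sg D G \<Phi> (stronger s (ren r1 a) (ren r1 a))"
      "valid Sg D G \<Phi> (stronger s (ren r1 a) (ren r2 a))"
      "valid Sg D G \<Phi> (stronger s (ren r2 a) (ren r2 a))"
      using a r rel_env_refl[OF r] by (auto simp: monotone_tm_def)
  qed
  with assms show ?thesis by (auto simp: monotone_tm_def intro: has_ty.intros(2))
qed

lemma monotone_Pair:
  assumes a: "monotone_tm Sg D \<Gamma> a s" and b: "monotone_tm Sg D \<Gamma> b t"
  shows "monotone_tm Sg D \<Gamma> (Pair a b) (TProd s t)"
proof -
  have "valid Sg D G \<Phi> (stronger (TProd s t) (ren r1 (Pair a b)) (ren r2 (Pair a b)))"
    if r: "rel_env Sg D G \<Phi> \<Gamma> r1 r2" for G \<Phi> r1 r2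
  proof -
    have ty: "has_ty Sg D G (ren r a) s" "has_ty Sg D G (ren r b) t" if "r \<in> {r1, r2}" for r
      using that a b r by (auto simp: monotone_tm_def rel_env_def intro: has_ty_ren)
    \<comment> \<open>The relation at products speaks of projections, here redexes; the relation
      between components is carried back along beta.\<close>
    have "valid Sg D G \<Phi> (stronger s (Fst (Pair (ren r1 a) (ren r1 b))) (Fst (Pair (ren r2 a) (ren r2 b))))"
      by (rule valid_stronger_cong[OF valid.V_FstBeta valid.V_FstBeta])
        (use a r ty in \<open>auto simp: monotone_tm_def intro: has_ty.intros(5,6)\<close>)
    moreover have "valid Sg D G \<Phi> (stronger t (Snd (Pair (ren r1 a) (ren r1 b))) (Snd (Pair (ren r2 a) (ren r2 b))))"
      by (rule valid_stronger_cong[OF valid.V_SndBeta valid.V_SndBeta])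
        (use b r ty in \<open>auto simp: monotone_tm_def intro: has_ty.intros(5,7)\<close>)
    ultimately show ?thesis by (simp add: valid.V_AndI)
  qed
  with assms show ?thesis by (simp add: monotone_tm_def has_ty.intros(5) del: ren.simps stronger.simps)
qed

lemma monotone_Fst: "monotone_tm Sg D \<Gamma> a (TProd s t) \<Longrightarrow> monotone_tm Sg D \<Gamma> (Fst a) s"
  unfolding monotone_tm_def stronger.simps ren.simps wf_ty.simps
  by (blast intro: has_ty.intros(6) dest: valid.V_AndE1)

lemma monotone_Snd: "monotone_tm Sg D \<Gamma> a (TProd s t) \<Longrightarrow> monotone_tm Sg D \<Gamma> (Snd a) t"
  unfolding monotone_tm_def stronger.simps ren.simps wf_ty.simps
  by (blast intro: has_ty.intros(7) dest: valid.V_AndE2)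

lemma monotone_Inl: "monotone_tm Sg D \<Gamma> a s \<Longrightarrow> wf_ty D t \<Longrightarrow> monotone_tm Sg D \<Gamma> (Inl a) (TSum s t)"
  unfolding monotone_tm_def
  by (auto simp del: stronger.simps intro!: has_ty.intros(8) valid_stronger_Inl)
    (auto simp: rel_env_def intro: has_ty_ren)

lemma monotone_Inr: "monotone_tm Sg D \<Gamma> a t \<Longrightarrow> wf_ty D s \<Longrightarrow> monotone_tm Sg D \<Gamma> (Inr a) (TSum s t)"
  unfolding monotone_tm_def
  by (auto simp del: stronger.simps intro!: has_ty.intros(9) valid_stronger_Inr)
    (auto simp: rel_env_def intro: has_ty_ren)

section \<open>Case analysis on related scrutinees\<close>

lemma valid_Case_Inl_ren:
  assumes eq: "valid Sg D G \<Phi> (Eq (TSum s t) (ren r a) (Inl (Var j)))"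
    and ty: "has_ty Sg D \<Gamma> a (TSum s t)" "has_ty Sg D (s # \<Gamma>) b q" "has_ty Sg D (t # \<Gamma>) c q"
    and "wf_ty D t" and r: "ren_ok \<Gamma> r G" and j: "j < length G" "G ! j = s"
  shows "valid Sg D G \<Phi> (Eq q (ren r (Case a s b t c)) (ren (case_nat j r) b))"
proof -
  let ?b = "ren (up_ren r) b" and ?c = "ren (up_ren r) c"
  have bc: "has_ty Sg D (s # G) ?b q" "has_ty Sg D (t # G) ?c q"
    using ty r by (auto intro: has_ty_ren ren_ok_up)
  have "ren_ok (p # G) (up_ren Suc) (p # TSum s t # G)" for p
    by (simp add: ren_ok_up ren_ok_Suc)
  \<comment> \<open>The scrutinee becomes a hole at index 0. The branches are weakened past it,
    below their own binder, by \<open>up_ren Suc\<close>.\<close>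
  then have "has_ty Sg D (TSum s t # G) (Case (Var 0) s (ren (up_ren Suc) ?b) t (ren (up_ren Suc) ?c)) q"
    using bc by (intro has_ty.intros(10)) (auto intro: has_ty_Var has_ty_ren)
  from valid_Eq_cong[OF eq this]
  have 1: "valid Sg D G \<Phi> (Eq q (ren r (Case a s b t c)) (Case (Inl (Var j)) s ?b t ?c))"
    using has_ty_ren[OF has_ty.intros(10)[OF ty] r]
    by (simp add: subst_Suc_ren_up_Suc)
  have "valid Sg D G \<Phi> (Eq q (Case (Inl (Var j)) s ?b t ?c) (ren (case_nat j r) b))"
    using valid.V_CaseInl[OF assms(5) has_ty_Var[OF j] bc] by (simp add: subst0_ren_up)
  with 1 show ?thesis
    using has_ty_ren[OF has_ty.intros(10)[OF ty] r] by (rule valid_Eq_trans)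
qed

lemma valid_Case_Inr_ren:
  assumes eq: "valid Sg D G \<Phi> (Eq (TSum s t) (ren r a) (Inr (Var j)))"
    and ty: "has_ty Sg D \<Gamma> a (TSum s t)" "has_ty Sg D (s # \<Gamma>) b q" "has_ty Sg D (t # \<Gamma>) c q"
    and "wf_ty D s" and r: "ren_ok \<Gamma> r G" and j: "j < length G" "G ! j = t"
  shows "valid Sg D G \<Phi> (Eq q (ren r (Case a s b t c)) (ren (case_nat j r) c))"
proof -
  let ?b = "ren (up_ren r) b" and ?c = "ren (up_ren r) c"
  have bc: "has_ty Sg D (s # G) ?b q" "has_ty Sg D (t # G) ?c q"
    using ty r by (auto intro: has_ty_ren ren_ok_up)
  have "ren_ok (p # G) (up_ren Suc) (p # TSum s t # G)" for p
    by (simp add: ren_ok_up ren_ok_Suc)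
  then have "has_ty Sg D (TSum s t # G) (Case (Var 0) s (ren (up_ren Suc) ?b) t (ren (up_ren Suc) ?c)) q"
    using bc by (intro has_ty.intros(10)) (auto intro: has_ty_Var has_ty_ren)
  from valid_Eq_cong[OF eq this]
  have 1: "valid Sg D G \<Phi> (Eq q (ren r (Case a s b t c)) (Case (Inr (Var j)) s ?b t ?c))"
    using has_ty_ren[OF has_ty.intros(10)[OF ty] r]
    by (simp add: subst_Suc_ren_up_Suc)
  have "valid Sg D G \<Phi> (Eq q (Case (Inr (Var j)) s ?b t ?c) (ren (case_nat j r) c))"
    using valid.V_CaseInr[OF assms(5) has_ty_Var[OF j] bc] by (simp add: subst0_ren_up)
  with 1 show ?thesis
    using has_ty_ren[OF has_ty.intros(10)[OF ty] r] by (rule valid_Eq_trans)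
qed

lemma monotone_Case:
  assumes a: "monotone_tm Sg D \<Gamma> a (TSum s t)"
    and b: "monotone_tm Sg D (s # \<Gamma>) b q" and c: "monotone_tm Sg D (t # \<Gamma>) c q"
  shows "monotone_tm Sg D \<Gamma> (Case a s b t c) q"
proof -
  have wf: "wf_ty D s" "wf_ty D t" "wf_ty D q"
    and ty: "has_ty Sg D \<Gamma> a (TSum s t)" "has_ty Sg D (s # \<Gamma>) b q" "has_ty Sg D (t # \<Gamma>) c q"
    using assms by (auto simp: monotone_tm_def)
  let ?e = "Case a s b t c"
  have tye: "has_ty Sg D \<Gamma> ?e q"
    using ty by (rule has_ty.intros(10))
  have "valid Sg D G \<Phi> (stronger q (ren r1 ?e) (ren r2 ?e))"
    if r: "rel_env Sg D G \<Phi> \<Gamma> r1 r2" for G \<Phi> r1 r2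
  proof -
    \<comment> \<open>Opening the relation on the scrutinee binds two payloads, which shifts both
      environments by two.\<close>
    let ?r1 = "Suc \<circ> Suc \<circ> r1" and ?r2 = "Suc \<circ> Suc \<circ> r2"
    have ok: "ren_ok \<Gamma> r1 G" "ren_ok \<Gamma> r2 G"
      using r by (auto simp: rel_env_def)
    have rel: "valid Sg D G \<Phi> (stronger (TSum s t) (ren r1 a) (ren r2 a))"
      using a r by (auto simp: monotone_tm_def simp del: stronger.simps)
    show ?thesis
    proof (rule valid_stronger_TSumE[OF rel has_ty_ren[OF ty(1) ok(1)] has_ty_ren[OF ty(1) ok(2)] wf(1,2)];
        unfold lift_stronger lift2_ren)
      fix \<Phi>' assume P: "lift2 ` set \<Phi> \<subseteq> set \<Phi>'"
        and h: "valid Sg D (s # s # G) \<Phi>' (Eq (TSum s t) (ren ?r1 a) (Inl (Var 1)))"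
          "valid Sg D (s # s # G) \<Phi>' (Eq (TSum s t) (ren ?r2 a) (Inl (Var 0)))"
          "valid Sg D (s # s # G) \<Phi>' (stronger s (Var 1) (Var 0))"
      have r': "rel_env Sg D (s # s # G) \<Phi>' \<Gamma> ?r1 ?r2"
        using rel_env_lift2[OF r P] .
      then have ok': "ren_ok \<Gamma> ?r1 (s # s # G)" "ren_ok \<Gamma> ?r2 (s # s # G)"
        by (auto simp: rel_env_def)
      \<comment> \<open>The diagonal environments relate each scrutinee to itself; this is what
        makes each payload related to itself.\<close>
      have aa: "valid Sg D (s # s # G) \<Phi>' (stronger (TSum s t) (ren ?r1 a) (ren ?r1 a))"
        "valid Sg D (s # s # G) \<Phi>' (stronger (TSum s t) (ren ?r2 a) (ren ?r2 a))"
        using a rel_env_refl[OF r'] by (simp_all add: monotone_tm_def del: stronger.simps)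
      have v: "has_ty Sg D (s # s # G) (Var 1) s" "has_ty Sg D (s # s # G) (Var 0) s"
        by (simp_all add: has_ty_Var)
      have "valid Sg D (s # s # G) \<Phi>' (stronger s (Var 1) (Var 1))"
        "valid Sg D (s # s # G) \<Phi>' (stronger s (Var 0) (Var 0))"
        using valid_stronger_refl_Inl[OF aa(1) h(1) has_ty_ren[OF ty(1) ok'(1)] v(1) wf(1,2)]
          valid_stronger_refl_Inl[OF aa(2) h(2) has_ty_ren[OF ty(1) ok'(2)] v(2) wf(1,2)] .
      then have r'': "rel_env Sg D (s # s # G) \<Phi>' (s # \<Gamma>) (case_nat 1 ?r1) (case_nat 0 ?r2)"
        using h(3) by (intro rel_env_Cons[OF r']) auto
      then have "valid Sg D (s # s # G) \<Phi>' (stronger q (ren (case_nat 1 ?r1) b) (ren (case_nat 0 ?r2) b))"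
        using b by (simp add: monotone_tm_def)
      \<comment> \<open>Each case term equals its left branch with the payload variable, so the
        relation between the branches transfers.\<close>
      from valid_stronger_cong[OF valid_Case_Inl_ren[OF h(1) ty wf(2) ok'(1)]
          valid_Case_Inl_ren[OF h(2) ty wf(2) ok'(2)] _ _ _ wf(3) this]
      show "valid Sg D (s # s # G) \<Phi>' (stronger q (ren ?r1 ?e) (ren ?r2 ?e))"
        using has_ty_ren[OF tye ok'(1)] has_ty_ren[OF tye ok'(2)] ty(2) r''
        by (auto simp: rel_env_def simp del: ren.simps intro: has_ty_ren)
    next
      fix \<Phi>' assume P: "lift2 ` set \<Phi> \<subseteq> set \<Phi>'"
        and h: "valid Sg D (t # t # G) \<Phi>' (Eq (TSum s t) (ren ?r1 a) (Inr (Var 1)))"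
          "valid Sg D (t # t # G) \<Phi>' (Eq (TSum s t) (ren ?r2 a) (Inr (Var 0)))"
          "valid Sg D (t # t # G) \<Phi>' (stronger t (Var 1) (Var 0))"
      have r': "rel_env Sg D (t # t # G) \<Phi>' \<Gamma> ?r1 ?r2"
        using rel_env_lift2[OF r P] .
      then have ok': "ren_ok \<Gamma> ?r1 (t # t # G)" "ren_ok \<Gamma> ?r2 (t # t # G)"
        by (auto simp: rel_env_def)
      have aa: "valid Sg D (t # t # G) \<Phi>' (stronger (TSum s t) (ren ?r1 a) (ren ?r1 a))"
        "valid Sg D (t # t # G) \<Phi>' (stronger (TSum s t) (ren ?r2 a) (ren ?r2 a))"
        using a rel_env_refl[OF r'] by (simp_all add: monotone_tm_def del: stronger.simps)
      have v: "has_ty Sg D (t # t # G) (Var 1) t" "has_ty Sg D (t # t # G) (Var 0) t"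
        by (simp_all add: has_ty_Var)
      have "valid Sg D (t # t # G) \<Phi>' (stronger t (Var 1) (Var 1))"
        "valid Sg D (t # t # G) \<Phi>' (stronger t (Var 0) (Var 0))"
        using valid_stronger_refl_Inr[OF aa(1) h(1) has_ty_ren[OF ty(1) ok'(1)] v(1) wf(1,2)]
          valid_stronger_refl_Inr[OF aa(2) h(2) has_ty_ren[OF ty(1) ok'(2)] v(2) wf(1,2)] .
      then have r'': "rel_env Sg D (t # t # G) \<Phi>' (t # \<Gamma>) (case_nat 1 ?r1) (case_nat 0 ?r2)"
        using h(3) by (intro rel_env_Cons[OF r']) auto
      then have "valid Sg D (t # t # G) \<Phi>' (stronger q (ren (case_nat 1 ?r1) c) (ren (case_nat 0 ?r2) c))"
        using c by (simp add: monotone_tm_def)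
      from valid_stronger_cong[OF valid_Case_Inr_ren[OF h(1) ty wf(1) ok'(1)]
          valid_Case_Inr_ren[OF h(2) ty wf(1) ok'(2)] _ _ _ wf(3) this]
      show "valid Sg D (t # t # G) \<Phi>' (stronger q (ren ?r1 ?e) (ren ?r2 ?e))"
        using has_ty_ren[OF tye ok'(1)] has_ty_ren[OF tye ok'(2)] ty(3) r''
        by (auto simp: rel_env_def simp del: ren.simps intro: has_ty_ren)
    qed
  qed
  with tye wf show ?thesis by (simp add: monotone_tm_def del: ren.simps)
qed


section \<open>Monotonicity of the translation\<close>

text \<open>One induction proves both claims, since computational types have value types as
  components.\<close>

lemma wf_star_ty:
  "val_ty \<Delta> H \<Longrightarrow> wf_ty (star_tctx \<Delta>) (star_ty H)" "comp_ty \<Delta> H \<Longrightarrow> wf_ty (star_tctx \<Delta>) (star_ty H)"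
proof (induction H)
  case (DFun \<epsilon> H H')
  { case 1 with DFun show ?case by (cases \<epsilon>) auto }
  { case 2 with DFun show ?case by (cases \<epsilon>) auto }
qed (auto simp: star_tctx_def)

lemma wf_star_ty_dm: "dm_ty \<Delta> H \<Longrightarrow> wf_ty (star_tctx \<Delta>) (star_ty H)"
  by (auto simp: dm_ty_def wf_star_ty)

lemma dm_star_wf: "dm_star Sg \<Delta> \<Gamma> e H \<epsilon> u \<Longrightarrow> dm_ty \<Delta> H \<and> (\<epsilon> = EffTau \<longrightarrow> val_ty \<Delta> H)"
  using dm_typing_wf dm_typing_iff_dm_star by metis

text \<open>At effect \<open>EffTau\<close> this is the continuation monad with answer type
  \<open>Type0\<close>, that is, predicate transformers on postconditions.\<close>

fun star_res_ty :: "eff \<Rightarrow> 'b dty \<Rightarrow> 'b ty" where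
  "star_res_ty EffN H = star_ty H"
| "star_res_ty EffTau A = TFun (TFun (star_ty A) Type0) Type0"

lemma star_ty_DFun: "star_ty (DFun \<epsilon> H H') = TFun (star_ty H) (star_res_ty \<epsilon> H')"
  by (cases \<epsilon>) simp_all

text \<open>The fundamental lemma of the logical relation. Homomorphic cases are the closure lemmas;
  \<open>return\<close> and \<open>bind\<close> are assembled from abstraction, application and
  renaming.\<close>

lemma monotone_dm_star:
  assumes "dm_star Sg \<Delta> \<Gamma> e H \<epsilon> u"
  shows "monotone_tm Sg (star_tctx \<Delta>) (map star_ty \<Gamma>) u (star_res_ty \<epsilon> H)"
  using assms
proof (induction rule: dm_star.induct)
  case (S_Var \<Gamma> i)
  then show ?case
    using monotone_Var[of i "map star_ty \<Gamma>" "star_tctx \<Delta>" Sg] by (simp add: wf_star_ty_dm)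
next
  case (S_Const \<Gamma> k bs b es es')
  then show ?case by (simp add: monotone_Const)
next
  case (S_Lam \<epsilon> H H' \<Gamma> e u)
  then have "wf_ty (star_tctx \<Delta>) (star_ty H)"
    using wf_star_ty_dm[of \<Delta> "DFun \<epsilon> H H'"] by (simp add: star_ty_DFun)
  with S_Lam show ?case by (simp add: star_ty_DFun monotone_Lam)
next
  case (S_App \<Gamma> f \<epsilon> H H' u e v)
  then show ?case by (auto simp: star_ty_DFun intro: monotone_App)
next
  case (S_Inl A A' \<Gamma> e u)
  then show ?case by (auto intro: monotone_Inl wf_star_ty)
next
  case (S_Inr A A' \<Gamma> e u)
  then show ?case by (auto intro: monotone_Inr wf_star_ty)
next
  case (S_Return A \<Gamma> e u)
  let ?p = "TFun (star_ty A) Type0"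
  have wf: "wf_ty (star_tctx \<Delta>) ?p"
    using S_Return by (simp add: wf_star_ty)
  have p: "monotone_tm Sg (star_tctx \<Delta>) (?p # map star_ty \<Gamma>) (Var 0) ?p"
    using monotone_Var[of 0 "?p # map star_ty \<Gamma>"] wf by fastforce
  have "monotone_tm Sg (star_tctx \<Delta>) (?p # map star_ty \<Gamma>) (lift 0 u) (star_ty A)"
    unfolding lift0_eq_ren using S_Return by (intro monotone_tm_ren[OF _ ren_ok_Suc]) simp
  then show ?case
    unfolding star_res_ty.simps by (intro monotone_Lam[OF wf] monotone_App[OF p])
next
  case (S_Bind \<Gamma> e1 A u e2 A' v)
  let ?p = "TFun (star_ty A') Type0" and ?G = "map star_ty \<Gamma>"
  have wf: "wf_ty (star_tctx \<Delta>) ?p" "wf_ty (star_tctx \<Delta>) (star_ty A)"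
    using S_Bind.hyps[THEN dm_star_wf] by (simp_all add: wf_star_ty)
  have p: "monotone_tm Sg (star_tctx \<Delta>) (star_ty A # ?p # ?G) (Var 1) ?p"
    using monotone_Var[of 1 "star_ty A # ?p # ?G"] wf by fastforce
  have u: "monotone_tm Sg (star_tctx \<Delta>) (?p # ?G) (lift 0 u) (TFun (TFun (star_ty A) Type0) Type0)"
    unfolding lift0_eq_ren using S_Bind by (intro monotone_tm_ren[OF _ ren_ok_Suc]) simp
  \<comment> \<open>\<open>lift 1\<close> inserts the postcondition between the bound result, which
    keeps index 0, and the older variables.\<close>
  have "ren_ok (star_ty A # ?G) (\<lambda>i. if i < 1 then i else Suc i) (star_ty A # ?p # ?G)"
    by (auto simp: ren_ok_def nth_Cons')
  then have "monotone_tm Sg (star_tctx \<Delta>) (star_ty A # ?p # ?G) (lift 1 v) (TFun ?p Type0)"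
    unfolding lift_eq_ren using S_Bind by (intro monotone_tm_ren) auto
  then show ?case
    unfolding star_res_ty.simps
    by (intro monotone_Lam[OF wf(1)] monotone_App[OF u] monotone_Lam[OF wf(2)] monotone_App[OF _ p])
qed (auto intro: monotone_Pair monotone_Fst monotone_Snd monotone_Case)

theorem theorem7:
  fixes Sg :: "('k, 'b) signature" and \<Delta> :: "tyvar list"
    and e :: "('b, 'k) dtm" and e_star :: "('b, 'k) tm" and C :: "'b dty"
  assumes "comp_ty \<Delta> C"
    and "dm_typing Sg \<Delta> [] e C EffN"
    and "dm_star Sg \<Delta> [] e C EffN e_star"
  shows "valid Sg (star_tctx \<Delta>) [] [] (stronger (star_ty C) e_star e_star)"
proof -
  \<comment> \<open>A closed term has no variables to relate, so identity renamings form an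
    environment without any hypotheses.\<close>
  have "rel_env Sg (star_tctx \<Delta>) [] [] [] id id"
    by (simp add: rel_env_def ren_ok_def)
  then have "valid Sg (star_tctx \<Delta>) [] [] (stronger (star_ty C) (ren id e_star) (ren id e_star))"
    using monotone_dm_star[OF assms(3)] by (simp add: monotone_tm_def)
  then show ?thesis by (simp add: ren_eq_msub[of id])
qed

end
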